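(* Let $m$ and $n$ be positive integers with $n\ge 2$, let $\Bbbk$ be a field of characteristic zero, let $R=\Bbbk[u_1,u_2,\ldots,u_m]$ and let $(\alpha_{ij})\in M_{m\times n}(\Bbbk)$. Write $u=(u_1,\ldots,u_m)$ and $\alpha_i=(\alpha_{1i},\alpha_{2i},\ldots,\alpha_{mi})$. Let $(p_1,p_2,\ldots,p_n)\in R^n$ be an $n$-tuple of monic polynomials satisfying $$p_i(u-\tfrac{\alpha_j}{2})\cdot p_j(u-\tfrac{\alpha_i}{2})=p_i(u+\tfrac{\alpha_j}{2})\cdot p_j(u+\tfrac{\alpha_i}{2})\qquad\forall i\neq j.\qquad ( * )$$ Then there exist: (i) a finite set of (distinct) orbits $\mathcal{O}^{(1)},\mathcal{O}^{(2)},\ldots,\mathcal{O}^{(d)}\in\operatorname{Irr}(R)/\mathbb{Z}^n$ in the set $\operatorname{Irr}(R)$ of monic irreducible elements, with respect to the action of $\mathbb{Z}^n$ by $\Bbbk$-algebra automorphisms on $R$ determined by $\boldsymbol{x}.u_j=u_j-\sum_{i=1}^n x_i\alpha_{ji}$ for all $\boldsymbol{x}=\sum_{i=1}^n x_i\boldsymbol{e}_i\in\mathbb{Z}^n$; (ii) for each orbit $\mathcal{O}^{(a)}$, a $2$-subset $\{i_a,j_a\}\subseteq\{1,2,\ldots,n\}$ such that for all $k\in\{1,2,\ldots,n\}\setminus\{i_a,j_a\}$ we have $\boldsymbol{e}_k.q=q$ for all $q\in\mathcal{O}^{(a)}$; (iii) for each orbit $\mathcal{O}^{(a)}$, a finite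 higher spin $6$-vertex configuration $\mathcal{L}^{(a)}$ in $\mathcal{O}^{(a)}$ with index set $\{i_a,j_a\}$, such that $$p_k=p_k^{(1)}p_k^{(2)}\cdots p_k^{(d)}\qquad\forall k\in\{1,2,\ldots,n\},\qquad ( ** )$$ where $$p_k^{(a)}=\begin{cases}\displaystyle\prod_{f\in E_k(\mathcal{O}^{(a)})}f^{\mathcal{L}^{(a)}_k(f)},&\text{if }k\in\{i_a,j_a\},\\ 1,&\text{otherwise.}\end{cases}$$ Conversely, given orbits $\mathcal{O}^{(a)}$, $2$-subsets $\{i_a,j_a\}$ and vertex configurations $\mathcal{L}^{(a)}$ as in (i)--(iii), the $n$-tuple $(p_1,\ldots,p_n)$ defined by $( ** )$ satisfies the equations $( * )$. Moreover, for any $n$-tuple of monic polynomials $(p_1,\ldots,p_n)$ satisfying $( * )$, the following relations hold (non-vacuously when $n\ge 3$): $$p_k(u-\tfrac{\alpha_i}{2}-\tfrac{\alpha_j}{2})\,p_k(u+\tfrac{\alpha_i}{2}+\tfrac{\alpha_j}{2})=p_k(u-\tfrac{\alpha_i}{2}+\tfrac{\alpha_j}{2})\,p_k(u+\tfrac{\alpha_i}{2}-\tfrac{\alpha_j}{2})\qquad\forall i\neq j\neq k\neq i.$$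
   Context: Fix a monomial order on $R$ (e.g. lexicographic); a nonzero polynomial is monic if its leading monomial has coefficient $1$. $\operatorname{Irr}(R)$ is the set of monic irreducible polynomials in $R$. For $1\le i\le n$, $\sigma_i$ is the $\Bbbk$-algebra automorphism of $R$ with $\sigma_i(u_j)=u_j-\alpha_{ji}$, and $\sigma_i^{\pm1/2}$ is given by $\sigma_i^{\pm1/2}(u_j)=u_j\mp\frac12\alpha_{ji}$. The standard basis vector $\boldsymbol{e}_i\in\mathbb{Z}^n$ acts as $\sigma_i$. These automorphisms preserve $\operatorname{Irr}(R)$. For an orbit $\mathcal{O}\in\operatorname{Irr}(R)/\mathbb{Z}^n$ put $E_k(\mathcal{O})=\sigma_k^{1/2}(\mathcal{O})=\{\sigma_k^{1/2}(q)\mid q\in\mathcal{O}\}$ and, for $i\ne j$, $V_{ij}(\mathcal{O})=\sigma_i^{1/2}\sigma_j^{1/2}(\mathcal{O})$. A higher spin $6$-vertex configuration in $\mathcal{O}$ with index set $\{i,j\}$ ($i\neq j$) is a pair $\mathcal{L}=(\mathcal{L}_i,\mathcal{L}_j)$ of functions $\mathcal{L}_i:E_i(\mathcal{O})\to\mathbb{Z}_{\ge0}$, $\mathcal{L}_j:E_j(\mathcal{O})\to\mathbb{Z}_{\ge0}$ such that for every $v\in V_{ij}(\mathcal{O})$ $$\mathcal{L}_i(\sigma_j^{1/2}(v))+\mathcal{L}_j(\sigma_i^{1/2}(v))=\mathcal{L}_i(\sigma_j^{-1/2}(v))+\mathcal{L}_j(\sigma_i^{-1/2}(v)).$$ It is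 finite if each of $\mathcal{L}_i,\mathcal{L}_j$ is nonzero at only finitely many edges.
   Formalization: In (i) the orbits are distinct except that a one-element orbit {q} with q dividing at least three of the p_k may recur with different 2-subsets; as written the claim fails for n=3, α=0, p_1=p_2=p_3=u_1. *)

theory Defs
  imports
    "HOL-Analysis.Finite_Cartesian_Product"
    "HOL-Library.Poly_Mapping"
    "HOL-Computational_Algebra.Factorial_Ring"
begin

text \<open>
  The polynomial ring \<open>\<bbbk>[u\<^sub>j | j :: 'm]\<close>: a monomial is its exponent vector \<open>'m \<Rightarrow>\<^sub>0 nat\<close>, and a polynomial
  is a finitely supported map from monomials to coefficients.
\<close>
type_synonym ('m, 'k) mpoly = "('m \<Rightarrow>\<^sub>0 nat) \<Rightarrow>\<^sub>0 'k"

definition Const :: "'k::comm_ring_1 \<Rightarrow> ('m, 'k) mpoly" where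
  "Const c = Poly_Mapping.single 0 c"

definition Var :: "'m \<Rightarrow> ('m, 'k::comm_ring_1) mpoly" where
  "Var j = Poly_Mapping.single (Poly_Mapping.single j 1) 1"

text \<open>\<open>subst f\<close> is the \<open>\<bbbk>\<close>-algebra endomorphism determined by \<open>u\<^sub>j \<mapsto> f j\<close>.\<close>
definition subst ::
    "('m::finite \<Rightarrow> ('m, 'k::comm_ring_1) mpoly) \<Rightarrow> ('m, 'k) mpoly \<Rightarrow> ('m, 'k) mpoly" where
  "subst f p =
     (\<Sum>s\<in>Poly_Mapping.keys p.
        Const (Poly_Mapping.lookup p s) * (\<Prod>j\<in>UNIV. f j ^ Poly_Mapping.lookup s j))"

text \<open>\<open>p at_plus v\<close> is \<open>p(u + v)\<close>.\<close>
definition at_plus ::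
    "('m::finite, 'k::comm_ring_1) mpoly \<Rightarrow> 'k ^ 'm \<Rightarrow> ('m, 'k) mpoly" (infixl "at'_plus" 75) where
  "p at_plus v = subst (\<lambda>j. Var j + Const (v $ j)) p"

text \<open>
  The condition that \<open>0\<close> (the monomial \<open>1\<close>) is least is, for finitely many variables, equivalent to
  the order being a well-order.
\<close>
definition monomial_order :: "('m \<Rightarrow>\<^sub>0 nat) rel \<Rightarrow> bool" where
  "monomial_order r \<longleftrightarrow>
     linear_order r \<and> (\<forall>s. (0, s) \<in> r) \<and> (\<forall>s t w. (s, t) \<in> r \<longrightarrow> (s + w, t + w) \<in> r)"

definition leading_monomial :: "('m \<Rightarrow>\<^sub>0 nat) rel \<Rightarrow> ('m, 'k::zero) mpoly \<Rightarrow> ('m \<Rightarrow>\<^sub>0 nat)" where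
  "leading_monomial r p =
     (THE s. s \<in> Poly_Mapping.keys p \<and> (\<forall>t\<in>Poly_Mapping.keys p. (t, s) \<in> r))"

definition monic :: "('m \<Rightarrow>\<^sub>0 nat) rel \<Rightarrow> ('m, 'k::comm_ring_1) mpoly \<Rightarrow> bool" where
  "monic r p \<longleftrightarrow> p \<noteq> 0 \<and> Poly_Mapping.lookup p (leading_monomial r p) = 1"

definition Irr :: "('m \<Rightarrow>\<^sub>0 nat) rel \<Rightarrow> ('m, 'k::comm_ring_1) mpoly set" where
  "Irr r = {q. monic r q \<and> irreducible q}"

text \<open>
  \<open>A $ j $ i\<close> is \<open>\<alpha>\<^sub>j\<^sub>i\<close>, so \<open>column i A\<close> is the shift vector \<open>\<alpha>\<^sub>i\<close>.
\<close>
definition act ::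
    "'k::comm_ring_1 ^ 'n ^ 'm \<Rightarrow> int ^ 'n \<Rightarrow> ('m::finite, 'k) mpoly \<Rightarrow> ('m, 'k) mpoly" where
  "act A x = subst (\<lambda>j. Var j - Const (\<Sum>i\<in>UNIV. of_int (x $ i) * A $ j $ i))"

definition orbits ::
    "('m \<Rightarrow>\<^sub>0 nat) rel \<Rightarrow> 'k::comm_ring_1 ^ 'n ^ 'm \<Rightarrow> ('m::finite, 'k) mpoly set set" where
  "orbits r A = {range (\<lambda>x. act A x q) | q. q \<in> Irr r}"

definition half_col :: "'k::field ^ 'n ^ 'm \<Rightarrow> 'n \<Rightarrow> 'k ^ 'm" where
  "half_col A i = (1 / 2) *s column i A"

definition sigma_half ::
    "'k::field ^ 'n ^ 'm \<Rightarrow> 'n \<Rightarrow> ('m::finite, 'k) mpoly \<Rightarrow> ('m, 'k) mpoly" where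
  "sigma_half A i = subst (\<lambda>j. Var j - Const (1 / 2 * A $ j $ i))"

definition sigma_neg_half ::
    "'k::field ^ 'n ^ 'm \<Rightarrow> 'n \<Rightarrow> ('m::finite, 'k) mpoly \<Rightarrow> ('m, 'k) mpoly" where
  "sigma_neg_half A i = subst (\<lambda>j. Var j + Const (1 / 2 * A $ j $ i))"

definition edges ::
    "'k::field ^ 'n ^ 'm \<Rightarrow> ('m::finite, 'k) mpoly set \<Rightarrow> 'n \<Rightarrow> ('m, 'k) mpoly set" where
  "edges A Q k = sigma_half A k ` Q"

definition vertices ::
    "'k::field ^ 'n ^ 'm \<Rightarrow> ('m::finite, 'k) mpoly set \<Rightarrow> 'n \<Rightarrow> 'n \<Rightarrow> ('m, 'k) mpoly set" where
  "vertices A Q i j = (\<lambda>q. sigma_half A i (sigma_half A j q)) ` Q"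

text \<open>
  A configuration with index set \<open>{i, j}\<close> is stored in a function \<open>L\<close> of which only the values
  \<open>L k f\<close> with \<open>k \<in> {i, j}\<close> and \<open>f \<in> edges A Q k\<close> are ever used.
\<close>
definition vertex_config ::
    "'k::field ^ 'n ^ 'm \<Rightarrow> ('m::finite, 'k) mpoly set \<Rightarrow> 'n \<Rightarrow> 'n
      \<Rightarrow> ('n \<Rightarrow> ('m, 'k) mpoly \<Rightarrow> nat) \<Rightarrow> bool" where
  "vertex_config A Q i j L \<longleftrightarrow>
     i \<noteq> j \<and>
     (\<forall>v\<in>vertices A Q i j.
        L i (sigma_half A j v) + L j (sigma_half A i v) =
        L i (sigma_neg_half A j v) + L j (sigma_neg_half A i v))"

definition finite_config ::
    "'k::field ^ 'n ^ 'm \<Rightarrow> ('m::finite, 'k) mpoly set \<Rightarrow> 'n \<Rightarrow> 'n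
      \<Rightarrow> ('n \<Rightarrow> ('m, 'k) mpoly \<Rightarrow> nat) \<Rightarrow> bool" where
  "finite_config A Q i j L \<longleftrightarrow> (\<forall>k\<in>{i, j}. finite {f \<in> edges A Q k. L k f \<noteq> 0})"

text \<open>
  The product is taken over the edges with nonzero exponent, since a \<open>\<Prod>\<close> over an infinite set is \<open>1\<close>.
\<close>
definition config_factor ::
    "'k::field ^ 'n ^ 'm \<Rightarrow> ('m::finite, 'k) mpoly set \<Rightarrow> 'n \<Rightarrow> 'n
      \<Rightarrow> ('n \<Rightarrow> ('m, 'k) mpoly \<Rightarrow> nat) \<Rightarrow> 'n \<Rightarrow> ('m, 'k) mpoly" where
  "config_factor A Q i j L k =
     (if k \<in> {i, j} then \<Prod>f\<in>{f \<in> edges A Q k. L k f \<noteq> 0}. f ^ L k f else 1)"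

definition orbit_data ::
    "('m \<Rightarrow>\<^sub>0 nat) rel \<Rightarrow> 'k::field ^ 'n ^ 'm \<Rightarrow> nat \<Rightarrow> (nat \<Rightarrow> ('m::finite, 'k) mpoly set)
      \<Rightarrow> (nat \<Rightarrow> 'n) \<Rightarrow> (nat \<Rightarrow> 'n) \<Rightarrow> (nat \<Rightarrow> 'n \<Rightarrow> ('m, 'k) mpoly \<Rightarrow> nat) \<Rightarrow> bool" where
  "orbit_data r A d Q i j L \<longleftrightarrow>
     (\<forall>a\<in>{1..d}.
        Q a \<in> orbits r A \<and>
        i a \<noteq> j a \<and>
        (\<forall>k. k \<notin> {i a, j a} \<longrightarrow> (\<forall>q\<in>Q a. act A (axis k 1) q = q)) \<and>
        vertex_config A (Q a) (i a) (j a) (L a) \<and>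
        finite_config A (Q a) (i a) (j a) (L a))"

text \<open>
  Literal distinctness of the orbits cannot be demanded for every tuple: if \<open>\<alpha> = 0\<close>, \<open>n = 3\<close> and
  \<open>p\<^sub>1 = p\<^sub>2 = p\<^sub>3 = u\<^sub>1\<close>, then \<open>{u\<^sub>1}\<close> is the only orbit that can contribute, and a single 2-subset reaches
  only two of the three \<open>p\<^sub>k\<close>.  An orbit may therefore be listed again, with a different index set,
  but only in this unavoidable case: it is a single fixed polynomial dividing at least three
  of the \<open>p\<^sub>k\<close>.  For \<open>n = 2\<close>, or if no \<open>q \<in> Irr(R)\<close> fixed by the action divides three of the \<open>p\<^sub>k\<close>,
  this is \<open>inj_on Q {1..d}\<close>.
\<close>
definition orbits_distinct ::
    "('n \<Rightarrow> ('m, 'k::field) mpoly) \<Rightarrow> nat \<Rightarrow> (nat \<Rightarrow> ('m, 'k) mpoly set)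
      \<Rightarrow> (nat \<Rightarrow> 'n) \<Rightarrow> (nat \<Rightarrow> 'n) \<Rightarrow> bool" where
  "orbits_distinct p d Q i j \<longleftrightarrow>
     (\<forall>a\<in>{1..d}. \<forall>b\<in>{1..d}. a \<noteq> b \<and> Q a = Q b \<longrightarrow>
        {i a, j a} \<noteq> {i b, j b} \<and> (\<exists>q. Q a = {q} \<and> card {k. q dvd p k} \<ge> 3))"

definition consistent ::
    "'k::field ^ 'n ^ 'm \<Rightarrow> ('n \<Rightarrow> ('m::finite, 'k) mpoly) \<Rightarrow> bool" where
  "consistent A p \<longleftrightarrow>
     (\<forall>i j. i \<noteq> j \<longrightarrow>
        (p i at_plus - half_col A j) * (p j at_plus - half_col A i) =
        (p i at_plus half_col A j) * (p j at_plus half_col A i))"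

end

theory Submission
  imports Defs "HOL-Library.Multiset" "HOL-Computational_Algebra.Polynomial"
begin

text \<open>
  \<open>R\<close> is factorial and translations permute \<open>Irr(R)\<close>, so the consistency equations only concern the multiplicities
  \<open>\<ell>\<^sub>k(f)\<close> of \<open>f \<in> Irr(R)\<close> in \<open>p\<^sub>k\<close>, where they say \<open>\<delta>\<^sub>j \<ell>\<^sub>i = - \<delta>\<^sub>i \<ell>\<^sub>j\<close> for the central differences \<open>\<delta>\<^sub>k\<close>
  along \<open>\<alpha>\<^sub>k\<close>: this is the vertex condition.  For three distinct indices it gives
  \<open>\<delta>\<^sub>i \<delta>\<^sub>j \<ell>\<^sub>k = - \<delta>\<^sub>j \<delta>\<^sub>k \<ell>\<^sub>i = \<delta>\<^sub>k \<delta>\<^sub>i \<ell>\<^sub>j = - \<delta>\<^sub>i \<delta>\<^sub>j \<ell>\<^sub>k\<close>, hence \<open>\<delta>\<^sub>i \<delta>\<^sub>j \<ell>\<^sub>k = 0\<close>, which is the additional relation.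
  In characteristic zero a polynomial moved by \<open>\<alpha>\<^sub>k\<close> has an infinite orbit under it, so \<open>\<delta>\<^sub>k\<close> is injective on finitely
  supported functions there.  Therefore at most two of the \<open>\<alpha>\<^sub>k\<close> move an orbit that contributes a factor, and if some
  \<open>\<alpha>\<^sub>k\<close> does, no other \<open>\<ell>\<^sub>l\<close> with \<open>\<alpha>\<^sub>l\<close> fixing the orbit is nonzero on it.
\<close>

section \<open>Evaluation homomorphisms and translations\<close>

definition unital_hom :: "('a::comm_ring_1 \<Rightarrow> 'b::comm_ring_1) \<Rightarrow> bool" where
  "unital_hom h \<longleftrightarrow> h 0 = 0 \<and> h 1 = 1 \<and> (\<forall>a b. h (a + b) = h a + h b) \<and> (\<forall>a b. h (a * b) = h a * h b)"

lemma unital_homD: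
  assumes "unital_hom h"
  shows "h 0 = 0" "h 1 = 1" "h (a + b) = h a + h b" "h (a * b) = h a * h b"
  using assms by (auto simp: unital_hom_def)

context
  fixes h :: "'a::comm_ring_1 \<Rightarrow> 'b::comm_ring_1"
  assumes h: "unital_hom h"
begin

lemma unital_hom_uminus: "h (- a) = - h a"
proof -
  have "h (- a) + h a = h 0" using unital_homD(3)[OF h, of "- a" a] by simp
  then show ?thesis by (simp add: unital_homD(1)[OF h] eq_neg_iff_add_eq_0)
qed

lemma unital_hom_diff: "h (a - b) = h a - h b"
  using unital_homD(3)[OF h, of a "- b"] by (simp add: unital_hom_uminus)

lemma unital_hom_sum: "h (sum f S) = (\<Sum>x\<in>S. h (f x))"
  by (induction S rule: infinite_finite_induct) (auto simp: unital_homD[OF h])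

lemma unital_hom_prod: "h (prod f S) = (\<Prod>x\<in>S. h (f x))"
  by (induction S rule: infinite_finite_induct) (auto simp: unital_homD[OF h])

lemma unital_hom_power: "h (a ^ n) = h a ^ n"
  by (induction n) (auto simp: unital_homD[OF h])

lemma unital_hom_dvd: "a dvd b \<Longrightarrow> h a dvd h b"
  by (elim dvdE) (simp add: unital_homD[OF h])

end

lemma unital_hom_comp: "unital_hom g \<Longrightarrow> unital_hom h \<Longrightarrow> unital_hom (\<lambda>x. g (h x))"
  by (simp add: unital_hom_def)

lemma unital_hom_id: "unital_hom (\<lambda>x. x)"
  by (simp add: unital_hom_def)

lemma poly_mapping_sum_singles: "p = (\<Sum>s\<in>Poly_Mapping.keys p. Poly_Mapping.single s (Poly_Mapping.lookup p s))"
  by (rule poly_mapping_eqI)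
    (auto simp: lookup_sum lookup_single when_def in_keys_iff sum.delta)

lemma mult_eq_sum_singles:
  "p * q = (\<Sum>s\<in>Poly_Mapping.keys p. \<Sum>t\<in>Poly_Mapping.keys q.
     Poly_Mapping.single (s + t) (Poly_Mapping.lookup p s * Poly_Mapping.lookup q t))"
  by (subst poly_mapping_sum_singles[of p], subst poly_mapping_sum_singles[of q])
    (simp add: sum_product mult_single)

definition monom_ev :: "('m::finite \<Rightarrow> 'b::comm_ring_1) \<Rightarrow> ('m \<Rightarrow>\<^sub>0 nat) \<Rightarrow> 'b" where
  "monom_ev f s = (\<Prod>j\<in>UNIV. f j ^ Poly_Mapping.lookup s j)"

lemma monom_ev_0 [simp]: "monom_ev f 0 = 1"
  by (simp add: monom_ev_def)

lemma monom_ev_add: "monom_ev f (s + t) = monom_ev f s * monom_ev f t"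
  by (simp add: monom_ev_def lookup_add power_add prod.distrib)

lemma monom_ev_single: "monom_ev f (Poly_Mapping.single j n) = f j ^ n"
proof -
  have "monom_ev f (Poly_Mapping.single j n) = (\<Prod>i\<in>UNIV. if i = j then f j ^ n else 1)"
    unfolding monom_ev_def by (rule prod.cong) (auto simp: lookup_single when_def)
  then show ?thesis by simp
qed

text \<open>The coefficient map \<open>c\<close> is a parameter because two targets occur:
  \<open>subst\<close> takes \<open>c = Const\<close>, while \<open>expand\<close> lands in
  univariate polynomials over the ring.\<close>

definition ev ::
    "('k::comm_ring_1 \<Rightarrow> 'b::comm_ring_1) \<Rightarrow> ('m::finite \<Rightarrow> 'b) \<Rightarrow> ('m, 'k) mpoly \<Rightarrow> 'b" where
  "ev c f p = (\<Sum>s\<in>Poly_Mapping.keys p. c (Poly_Mapping.lookup p s) * monom_ev f s)"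

lemma ev_superset:
  assumes "unital_hom c" "finite S" "Poly_Mapping.keys p \<subseteq> S"
  shows "ev c f p = (\<Sum>s\<in>S. c (Poly_Mapping.lookup p s) * monom_ev f s)"
  unfolding ev_def by (rule sum.mono_neutral_left) (use assms in \<open>auto simp: in_keys_iff unital_homD[OF assms(1)]\<close>)

lemma ev_add:
  assumes "unital_hom c"
  shows "ev c f (p + q) = ev c f p + ev c f q"
proof -
  let ?S = "Poly_Mapping.keys p \<union> Poly_Mapping.keys q"
  have "Poly_Mapping.keys (p + q) \<subseteq> ?S" by (rule keys_add)
  then show ?thesis
    by (simp add: ev_superset[OF assms, of ?S] lookup_add unital_homD[OF assms] distrib_right sum.distrib)
qed

lemma ev_0 [simp]: "ev c f 0 = 0"
  by (simp add: ev_def)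

lemma ev_sum: "unital_hom c \<Longrightarrow> ev c f (sum g S) = (\<Sum>x\<in>S. ev c f (g x))"
  by (induction S rule: infinite_finite_induct) (auto simp: ev_add)

lemma ev_single:
  assumes "unital_hom c"
  shows "ev c f (Poly_Mapping.single s a) = c a * monom_ev f s"
  using ev_superset[OF assms, of "{s}" "Poly_Mapping.single s a" f]
  by (simp add: lookup_single split: if_splits)

lemma ev_mult:
  assumes "unital_hom c"
  shows "ev c f (p * q) = ev c f p * ev c f q"
proof -
  have "ev c f (p * q) = (\<Sum>s\<in>Poly_Mapping.keys p. \<Sum>t\<in>Poly_Mapping.keys q.
      (c (Poly_Mapping.lookup p s) * monom_ev f s) * (c (Poly_Mapping.lookup q t) * monom_ev f t))"
    by (subst mult_eq_sum_singles)
      (simp add: ev_sum[OF assms] ev_single[OF assms] monom_ev_add unital_homD[OF assms] mult_ac)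
  then show ?thesis by (simp add: ev_def sum_product)
qed

lemma unital_hom_ev:
  assumes "unital_hom c"
  shows "unital_hom (ev c f)"
proof -
  have "ev c f (Poly_Mapping.single 0 1) = 1"
    by (simp add: ev_single[OF assms] unital_homD[OF assms] del: single_one)
  then show ?thesis
    by (simp add: unital_hom_def ev_add[OF assms] ev_mult[OF assms])
qed

lemma unital_hom_Const: "unital_hom (Const :: 'k::comm_ring_1 \<Rightarrow> ('m, 'k) mpoly)"
  by (auto simp: unital_hom_def Const_def single_add mult_single)

lemmas Const_hom = unital_homD[OF unital_hom_Const] unital_hom_uminus[OF unital_hom_Const]
  unital_hom_diff[OF unital_hom_Const]

lemma ev_Const: "unital_hom c \<Longrightarrow> ev c f (Const a) = c a"
  by (simp add: Const_def ev_single)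

lemma ev_Var: "unital_hom c \<Longrightarrow> ev c f (Var j) = f j"
  by (simp add: Var_def ev_single monom_ev_single unital_homD(2))

lemma monom_ev_Var: "monom_ev Var s = Poly_Mapping.single s (1 :: 'k::comm_ring_1)"
proof -
  have pow: "Var j ^ n = Poly_Mapping.single (Poly_Mapping.single j n) (1::'k)" for j :: 'a and n
    by (induction n) (auto simp: Var_def mult_single simp flip: single_add)
  have "(\<Prod>j\<in>J. Var j ^ Poly_Mapping.lookup s j) =
      Poly_Mapping.single (\<Sum>j\<in>J. Poly_Mapping.single j (Poly_Mapping.lookup s j)) (1::'k)" for J
    by (induction J rule: infinite_finite_induct) (auto simp: pow mult_single)
  moreover have "(\<Sum>j\<in>UNIV. Poly_Mapping.single j (Poly_Mapping.lookup s j)) = s"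
    by (rule poly_mapping_eqI) (auto simp: lookup_sum lookup_single when_def sum.delta)
  ultimately show ?thesis by (simp add: monom_ev_def)
qed

text \<open>Universal property of the polynomial ring: every term is a constant times a product of
  variables. Identities such as \<open>tau_tau\<close> and \<open>poly_expand\<close> then need
  checking on \<open>Const\<close> and \<open>Var\<close> only.\<close>

lemma hom_eq_ev:
  assumes "unital_hom h"
  shows "h p = ev (\<lambda>a. h (Const a)) (\<lambda>j. h (Var j)) p"
proof -
  have "h (Poly_Mapping.single s a) = h (Const a) * monom_ev (\<lambda>j. h (Var j)) s" for s a
  proof -
    have "Poly_Mapping.single s a = Const a * monom_ev Var s"
      by (simp add: monom_ev_Var Const_def mult_single)
    then show ?thesis
      by (simp add: unital_homD[OF assms] monom_ev_def unital_hom_prod[OF assms] unital_hom_power[OF assms])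
  qed
  then show ?thesis
    by (subst poly_mapping_sum_singles[of p]) (simp add: unital_hom_sum[OF assms] ev_def)
qed

lemma hom_eqI:
  fixes h :: "('m::finite, 'k::comm_ring_1) mpoly \<Rightarrow> 'b::comm_ring_1"
  assumes "unital_hom h" "unital_hom h'"
    and "\<And>a. h (Const a) = h' (Const a)" "\<And>j. h (Var j) = h' (Var j)"
  shows "h p = h' p"
  using assms hom_eq_ev[of h p] hom_eq_ev[of h' p] by simp

abbreviation (input) tau ::
    "'k::comm_ring_1 ^ 'm \<Rightarrow> ('m::finite, 'k) mpoly \<Rightarrow> ('m, 'k) mpoly" where
  "tau v p \<equiv> p at_plus v"

lemma subst_eq_ev: "subst = ev Const"
  by (intro ext) (simp add: subst_def ev_def monom_ev_def)

lemma tau_eq_ev: "tau v = ev Const (\<lambda>j. Var j + Const (v $ j))"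
  by (intro ext) (simp add: at_plus_def subst_eq_ev)

lemma tau_ev: "tau v p = ev Const (\<lambda>j. Var j + Const (v $ j)) p"
  using tau_eq_ev by (rule fun_cong)

lemma unital_hom_tau: "unital_hom (tau v)"
  unfolding tau_eq_ev by (rule unital_hom_ev[OF unital_hom_Const])

lemmas tau_hom = unital_homD[OF unital_hom_tau] unital_hom_uminus[OF unital_hom_tau]
  unital_hom_diff[OF unital_hom_tau] unital_hom_power[OF unital_hom_tau]
  unital_hom_prod[OF unital_hom_tau] unital_hom_sum[OF unital_hom_tau]

lemma tau_Const [simp]: "tau v (Const a) = Const a"
  by (simp add: tau_ev ev_Const unital_hom_Const)

lemma tau_Var [simp]: "tau v (Var j) = Var j + Const (v $ j)"
  by (simp add: tau_ev ev_Var unital_hom_Const)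

lemma tau_tau [simp]: "tau v (tau w p) = tau (v + w) p"
proof (rule hom_eqI[of "\<lambda>p. tau v (tau w p)" "tau (v + w)"])
  show "unital_hom (\<lambda>p. tau v (tau w p))"
    by (rule unital_hom_comp[OF unital_hom_tau unital_hom_tau])
qed (auto simp: unital_hom_tau tau_hom Const_hom algebra_simps)

lemma tau_0 [simp]: "tau 0 p = p"
  by (rule hom_eqI[of "tau 0" "\<lambda>p. p"]) (auto simp: unital_hom_tau unital_hom_id Const_hom)

lemma tau_eq_iff: "tau v p = tau v q \<longleftrightarrow> p = q"
  by (metis tau_tau tau_0 left_minus)

lemma inj_tau: "inj_on (tau v) S"
  by (simp add: inj_on_def tau_eq_iff)

section \<open>The lattice action and the half shifts as translations\<close>

definition shift_vec :: "'k::comm_ring_1 ^ 'n ^ 'm \<Rightarrow> int ^ 'n \<Rightarrow> 'k ^ 'm" where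
  "shift_vec A x = (\<chi> j. \<Sum>i\<in>UNIV. of_int (x $ i) * A $ j $ i)"

lemma act_eq_tau: "act A x = tau (- shift_vec A x)"
  by (simp add: act_def tau_eq_ev subst_eq_ev shift_vec_def Const_hom)

lemma sigma_half_eq_tau: "sigma_half A i = tau (- half_col A i)"
  by (simp add: sigma_half_def tau_eq_ev subst_eq_ev half_col_def column_def Const_hom)

lemma sigma_neg_half_eq_tau: "sigma_neg_half A i = tau (half_col A i)"
  by (simp add: sigma_neg_half_def tau_eq_ev subst_eq_ev half_col_def column_def Const_hom)

lemma shift_vec_add: "shift_vec A (x + y) = shift_vec A x + shift_vec A y"
  by (simp add: shift_vec_def vec_eq_iff distrib_right sum.distrib)

lemma shift_vec_uminus: "shift_vec A (- x) = - shift_vec A x"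
  by (simp add: shift_vec_def vec_eq_iff sum_negf)

lemma shift_vec_0: "shift_vec A 0 = 0"
  by (simp add: shift_vec_def vec_eq_iff)

text \<open>Two halves give the full column since 2 is invertible. Written in this way, all later
  shifts are sums of half columns, composed by \<open>tau_tau\<close>.\<close>

lemma shift_vec_axis:
  fixes A :: "'k::field_char_0 ^ 'n ^ 'm"
  shows "shift_vec A (axis i 1) = half_col A i + half_col A i"
proof -
  have "shift_vec A (axis i 1) $ j = A $ j $ i" for j
  proof -
    have "(\<Sum>k\<in>UNIV. of_int (axis i 1 $ k) * A $ j $ k) = (\<Sum>k\<in>UNIV. if k = i then A $ j $ i else 0)"
      by (rule sum.cong) (auto simp: axis_def)
    then show ?thesis by (simp add: shift_vec_def)
  qed
  then show ?thesis
    by (simp add: vec_eq_iff half_col_def column_def)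
qed

section \<open>Leading terms\<close>

text \<open>The coefficient \<open>c\<close> may be 0, in which case \<open>s\<close> is only a
  strict upper bound. This makes the notion additive, with no case distinction for cancelling
  leading terms.\<close>

definition leads :: "('m \<Rightarrow>\<^sub>0 nat) rel \<Rightarrow> ('m \<Rightarrow>\<^sub>0 nat) \<Rightarrow> 'k::zero \<Rightarrow> ('m, 'k) mpoly \<Rightarrow> bool" where
  "leads r s c p \<longleftrightarrow> (\<forall>t\<in>Poly_Mapping.keys p. (t, s) \<in> r) \<and> Poly_Mapping.lookup p s = c"

context
  fixes r :: "('m::finite \<Rightarrow>\<^sub>0 nat) rel"
  assumes mo: "monomial_order r"
begin

lemma mo_refl: "(s, s) \<in> r"
  using mo by (simp add: monomial_order_def linear_order_on_def partial_order_on_def preorder_on_def refl_on_def)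

lemma mo_trans: "(s, t) \<in> r \<Longrightarrow> (t, w) \<in> r \<Longrightarrow> (s, w) \<in> r"
  using mo by (meson monomial_order_def linear_order_on_def partial_order_on_def preorder_on_def transD)

lemma mo_antisym: "(s, t) \<in> r \<Longrightarrow> (t, s) \<in> r \<Longrightarrow> s = t"
  using mo by (meson monomial_order_def linear_order_on_def partial_order_on_def antisymD)

lemma mo_total: "(s, t) \<in> r \<or> (t, s) \<in> r"
  using mo mo_refl by (cases "s = t") (auto simp: monomial_order_def linear_order_on_def total_on_def)

lemma mo_0: "(0, s) \<in> r"
  using mo by (simp add: monomial_order_def)

lemma mo_add_right: "(s, t) \<in> r \<Longrightarrow> (s + w, t + w) \<in> r"
  using mo by (simp add: monomial_order_def)

lemma mo_add: "(s, t) \<in> r \<Longrightarrow> (s', t') \<in> r \<Longrightarrow> (s + s', t + t') \<in> r"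
  by (metis mo_trans mo_add_right add.commute)

text \<open>In the order, \<open>a + b\<close> is at most \<open>s + b\<close>, which is at most
  \<open>s + t\<close>; equal ends force equality throughout. So the top monomial of a product comes
  from a single pair.\<close>

lemma mo_add_eqD:
  assumes "(a, s) \<in> r" "(b, t) \<in> r" "a + b = s + t"
  shows "a = s \<and> b = t"
proof -
  have "(s + t, s + b) \<in> r" using mo_add[OF assms(1) mo_refl[of b]] assms(3) by simp
  moreover have "(s + b, s + t) \<in> r" using mo_add[OF mo_refl[of s] assms(2)] .
  ultimately have "b = t" using mo_antisym[of "s + t" "s + b"] by simp
  then show ?thesis using assms(3) by simp
qed

lemma finite_has_mo_greatest:
  "finite S \<Longrightarrow> S \<noteq> {} \<Longrightarrow> \<exists>s\<in>S. \<forall>t\<in>S. (t, s) \<in> r"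
proof (induction S rule: finite_ne_induct)
  case (singleton x)
  then show ?case by (simp add: mo_refl)
next
  case (insert x F)
  then obtain s where s: "s \<in> F" "\<forall>t\<in>F. (t, s) \<in> r" by blast
  show ?case
  proof (cases "(x, s) \<in> r")
    case True
    then show ?thesis using s by blast
  next
    case False
    then have "(s, x) \<in> r" using mo_total by blast
    then have "\<forall>t\<in>insert x F. (t, x) \<in> r" using s mo_trans mo_refl by blast
    then show ?thesis by blast
  qed
qed

lemma leads_exists:
  assumes "p \<noteq> 0"
  shows "\<exists>s c. c \<noteq> 0 \<and> leads r s c p"
proof -
  have "Poly_Mapping.keys p \<noteq> {}" using assms by simp
  then obtain s where "s \<in> Poly_Mapping.keys p" "\<forall>t\<in>Poly_Mapping.keys p. (t, s) \<in> r"
    using finite_has_mo_greatest[of "Poly_Mapping.keys p"] by auto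
  then show ?thesis by (auto simp: leads_def in_keys_iff)
qed

lemma leads_leading_monomial:
  assumes "leads r s c p" "c \<noteq> 0"
  shows "leading_monomial r p = s"
  unfolding leading_monomial_def
proof (rule the_equality)
  show "s \<in> Poly_Mapping.keys p \<and> (\<forall>t\<in>Poly_Mapping.keys p. (t, s) \<in> r)"
    using assms by (auto simp: leads_def in_keys_iff)
next
  fix t assume "t \<in> Poly_Mapping.keys p \<and> (\<forall>u\<in>Poly_Mapping.keys p. (u, t) \<in> r)"
  moreover have "s \<in> Poly_Mapping.keys p" using assms by (auto simp: leads_def in_keys_iff)
  ultimately show "t = s" using assms mo_antisym by (auto simp: leads_def)
qed

lemma leads_unique:
  assumes "leads r s c p" "c \<noteq> 0" "leads r t d p" "d \<noteq> 0"
  shows "s = t \<and> c = d"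
  using assms leads_leading_monomial by (metis leads_def)

lemma monic_iff_leads:
  fixes p :: "('m, 'k::comm_ring_1) mpoly"
  shows "monic r p \<longleftrightarrow> (\<exists>s. leads r s 1 p)"
proof
  assume *: "monic r p"
  then obtain s c where s: "c \<noteq> 0" "leads r s c p"
    using leads_exists[of p] unfolding monic_def by auto
  with * leads_leading_monomial[OF s(2,1)] have "c = 1"
    by (auto simp: monic_def leads_def)
  then show "\<exists>s. leads r s 1 p" using s by blast
next
  assume "\<exists>s. leads r s 1 p"
  then obtain s where s: "leads r s 1 p" by blast
  then have "leading_monomial r p = s" "p \<noteq> 0"
    using leads_leading_monomial[OF s] by (auto simp: leads_def)
  then show "monic r p" using s by (auto simp: monic_def leads_def)
qed

lemma leads_0: "leads r s 0 0"
  by (simp add: leads_def)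

lemma leads_Const: "leads r 0 c (Const c)"
  by (auto simp: leads_def Const_def mo_refl)

lemma leads_1: "leads r 0 1 (1 :: ('m, 'k::comm_ring_1) mpoly)"
  using leads_Const[of "1::'k"] by (simp add: Const_hom del: single_one)

lemma leads_add:
  fixes p q :: "('m, 'k::comm_ring_1) mpoly"
  shows "leads r s c p \<Longrightarrow> leads r s d q \<Longrightarrow> leads r s (c + d) (p + q)"
  using Poly_Mapping.keys_add[of p q] by (auto simp: leads_def lookup_add)

lemma leads_sum:
  fixes f :: "'b \<Rightarrow> ('m, 'k::comm_ring_1) mpoly"
  shows "(\<And>x. x \<in> S \<Longrightarrow> leads r s (c x) (f x)) \<Longrightarrow> leads r s (\<Sum>x\<in>S. c x) (\<Sum>x\<in>S. f x)"
  by (induction S rule: infinite_finite_induct) (auto simp: leads_0 leads_add)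

text \<open>Lower terms become summands with coefficient 0 at \<open>s\<close>, which
  \<open>leads_add\<close> and \<open>leads_sum\<close> absorb.\<close>

lemma leads_smaller:
  assumes "leads r t c p" "(t, s) \<in> r" "t \<noteq> s"
  shows "leads r s 0 p"
proof -
  have "s \<notin> Poly_Mapping.keys p" using assms mo_antisym by (auto simp: leads_def)
  then show ?thesis using assms mo_trans by (auto simp: leads_def in_keys_iff)
qed

lemma leads_mult:
  fixes p q :: "('m, 'k::comm_ring_1) mpoly"
  assumes "leads r s c p" "leads r t d q"
  shows "leads r (s + t) (c * d) (p * q)"
proof -
  have le: "(a, s) \<in> r" "(b, t) \<in> r"
    if "a \<in> Poly_Mapping.keys p" "b \<in> Poly_Mapping.keys q" for a b
    using assms that by (auto simp: leads_def)
  have "(w, s + t) \<in> r" if "w \<in> Poly_Mapping.keys (p * q)" for w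
    using that keys_mult[of p q] le mo_add by blast
  moreover have "Poly_Mapping.lookup (p * q) (s + t) = c * d"
  proof -
    have "Poly_Mapping.lookup (p * q) (s + t) =
      (\<Sum>a\<in>Poly_Mapping.keys p. \<Sum>b\<in>Poly_Mapping.keys q.
        if a + b = s + t then Poly_Mapping.lookup p a * Poly_Mapping.lookup q b else 0)"
      by (subst mult_eq_sum_singles) (simp add: lookup_sum lookup_single when_def)
    also have "\<dots> = (\<Sum>a\<in>Poly_Mapping.keys p. \<Sum>b\<in>Poly_Mapping.keys q.
        if b = t then if a = s then c * d else 0 else 0)"
    proof (intro sum.cong refl)
      fix a b assume "a \<in> Poly_Mapping.keys p" "b \<in> Poly_Mapping.keys q"
      then have "a + b = s + t \<longleftrightarrow> a = s \<and> b = t" using mo_add_eqD[OF le] by blast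
      then show "(if a + b = s + t then Poly_Mapping.lookup p a * Poly_Mapping.lookup q b else 0) =
          (if b = t then if a = s then c * d else 0 else 0)"
        using assms by (auto simp: leads_def)
    qed
    also have "\<dots> = (if t \<in> Poly_Mapping.keys q then if s \<in> Poly_Mapping.keys p then c * d else 0 else 0)"
      by simp
    also have "\<dots> = c * d"
      using assms by (auto simp: leads_def in_keys_iff)
    finally show ?thesis .
  qed
  ultimately show ?thesis by (simp add: leads_def)
qed

text \<open>The product of the two leading coefficients is a nonzero coefficient of the
  product.\<close>

lemma mpoly_no_zero_divisors:
  fixes p q :: "('m, 'k::idom) mpoly"
  assumes "p * q = 0"
  shows "p = 0 \<or> q = 0"
proof (rule ccontr)
  assume *: "\<not> ?thesis"
  then obtain s c where p: "c \<noteq> 0" "leads r s c p" using leads_exists by blast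
  obtain t d where q: "d \<noteq> 0" "leads r t d q" using * leads_exists by blast
  have "leads r (s + t) (c * d) 0" using leads_mult[OF p(2) q(2)] assms by simp
  then show False using p q by (simp add: leads_def)
qed

text \<open>The exponents with this property include the unit vectors, since a variable plus a
  constant keeps its leading monomial, and are closed under addition by
  \<open>leads_mult\<close>.\<close>

lemma leads_tau_single: "leads r s 1 (tau v (Poly_Mapping.single s (1::'k::comm_ring_1)))"
proof -
  define P where "P s = leads r s 1 (tau v (Poly_Mapping.single s (1::'k)))" for s
  have P0: "P 0" using leads_1 by (simp add: P_def tau_hom)
  have Padd: "P (s + t)" if "P s" "P t" for s t
  proof -
    have eq: "Poly_Mapping.single (s + t) (1::'k) = Poly_Mapping.single s 1 * Poly_Mapping.single t 1"
      by (simp add: mult_single)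
    show ?thesis
      using leads_mult[OF that[unfolded P_def]] unfolding P_def eq tau_hom by simp
  qed
  have Pvar: "P (Poly_Mapping.single j 1)" for j
  proof -
    have "(0::'m \<Rightarrow>\<^sub>0 nat) \<noteq> Poly_Mapping.single j 1"
      by (metis lookup_single_eq lookup_zero one_neq_zero)
    then have "leads r (Poly_Mapping.single j 1) 0 (Const (v $ j))"
      using leads_smaller[OF leads_Const mo_0] by blast
    moreover have "leads r (Poly_Mapping.single j 1) 1 (Var j :: ('m, 'k) mpoly)"
      by (auto simp: leads_def Var_def mo_refl)
    ultimately have "leads r (Poly_Mapping.single j 1) (1 + 0) (Var j + Const (v $ j))"
      by (rule leads_add[rotated])
    then show ?thesis unfolding P_def Var_def[symmetric] tau_Var by simp
  qed
  have Psingle: "P (Poly_Mapping.single j n)" for j n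
  proof (induction n)
    case (Suc n)
    then show ?case
      using Padd[OF Pvar[of j] Suc.IH] by (simp flip: single_add)
  qed (simp add: P0)
  have "P (\<Sum>j\<in>J. Poly_Mapping.single j (Poly_Mapping.lookup s j))" for J
    by (induction J rule: infinite_finite_induct) (auto simp: P0 Padd Psingle)
  moreover have "(\<Sum>j\<in>UNIV. Poly_Mapping.single j (Poly_Mapping.lookup s j)) = s"
    by (rule poly_mapping_eqI) (auto simp: lookup_sum lookup_single when_def)
  ultimately show ?thesis by (metis P_def)
qed

text \<open>Translating term by term, monomials below \<open>s\<close> stay below \<open>s\<close>,
  so only the term at \<open>s\<close> contributes to the coefficient there.\<close>

lemma leads_tau:
  fixes p :: "('m, 'k::comm_ring_1) mpoly"
  assumes "leads r s c p"
  shows "leads r s c (tau v p)"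
proof -
  have "tau v p = (\<Sum>t\<in>Poly_Mapping.keys p. Const (Poly_Mapping.lookup p t) * tau v (Poly_Mapping.single t 1))"
  proof -
    have "p = (\<Sum>t\<in>Poly_Mapping.keys p. Const (Poly_Mapping.lookup p t) * Poly_Mapping.single t 1)"
      by (subst poly_mapping_sum_singles) (simp add: Const_def mult_single)
    then have "tau v p = tau v (\<Sum>t\<in>Poly_Mapping.keys p. Const (Poly_Mapping.lookup p t) * Poly_Mapping.single t 1)"
      by simp
    then show ?thesis by (simp add: tau_hom(4,9))
  qed
  moreover have "leads r s (if t = s then c else 0)
      (Const (Poly_Mapping.lookup p t) * tau v (Poly_Mapping.single t 1))"
    if "t \<in> Poly_Mapping.keys p" for t
  proof -
    have l: "leads r t (Poly_Mapping.lookup p t) (Const (Poly_Mapping.lookup p t) * tau v (Poly_Mapping.single t 1))"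
      using leads_mult[OF leads_Const[of "Poly_Mapping.lookup p t"] leads_tau_single[of t v]] by simp
    show ?thesis
      using l leads_smaller[OF l, of s] assms that by (auto simp: leads_def)
  qed
  ultimately have "leads r s (\<Sum>t\<in>Poly_Mapping.keys p. if t = s then c else 0) (tau v p)"
    by (simp only: leads_sum)
  moreover have "(\<Sum>t\<in>Poly_Mapping.keys p. if t = s then c else 0) = c"
    using assms by (auto simp: leads_def in_keys_iff)
  ultimately show ?thesis by simp
qed

lemma monic_tau: "monic r p \<Longrightarrow> monic r (tau v p)"
  unfolding monic_iff_leads using leads_tau by blast

lemma monic_mult: "monic r p \<Longrightarrow> monic r q \<Longrightarrow> monic r (p * q)"
  unfolding monic_iff_leads using leads_mult[of _ 1 p _ 1 q] by auto

lemma monic_mult_leftD: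
  fixes p q :: "('m, 'k::idom) mpoly"
  assumes "monic r p" "monic r (p * q)"
  shows "monic r q"
proof -
  obtain s where s: "leads r s 1 p" using assms(1) monic_iff_leads by blast
  have "q \<noteq> 0" using assms(2) by (auto simp: monic_def)
  then obtain t d where t: "d \<noteq> 0" "leads r t d q" using leads_exists by blast
  have "leads r (s + t) (1 * d) (p * q)" using leads_mult[OF s t(2)] .
  moreover obtain w where "leads r w 1 (p * q)" using assms(2) monic_iff_leads by blast
  ultimately have "d = 1" using leads_unique t(1) by (metis mult_1 one_neq_zero)
  then show ?thesis using t(2) monic_iff_leads by blast
qed

text \<open>
  A translation preserves leading terms, so \<open>\<Sum>i<n. \<tau>\<^sub>v\<^sup>i g\<close> has \<open>n\<close> times the leading coefficient of \<open>g\<close>;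
  for \<open>g = \<tau>\<^sub>v p - p\<close> the sum telescopes.
\<close>
lemma tau_fixed_if_funpow_fixed:
  fixes p :: "('m, 'k::field_char_0) mpoly"
  assumes "(tau v ^^ n) p = p" "n > 0"
  shows "tau v p = p"
proof (rule ccontr)
  assume "tau v p \<noteq> p"
  define g where "g = tau v p - p"
  with \<open>tau v p \<noteq> p\<close> obtain s c where s: "c \<noteq> 0" "leads r s c g" using leads_exists[of g] by auto
  have iter: "leads r s c ((tau v ^^ i) g)" for i
    by (induction i) (auto simp: s leads_tau)
  have g: "(tau v ^^ i) g = (tau v ^^ Suc i) p - (tau v ^^ i) p" for i
    by (induction i) (auto simp: g_def tau_hom simp del: tau_tau)
  have "(\<Sum>i<n. (tau v ^^ i) g) = (tau v ^^ n) p - p"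
    unfolding g by (subst sum_lessThan_telescope) simp
  then have "(\<Sum>i<n. (tau v ^^ i) g) = 0" using assms(1) by simp
  moreover have "leads r s (\<Sum>i<n. c) (\<Sum>i<n. (tau v ^^ i) g)"
    using iter by (intro leads_sum) auto
  \<comment> \<open>Characteristic zero: the coefficient at \<open>s\<close> is \<open>n\<close>
    times \<open>c\<close>, hence nonzero, although the sum itself is 0.\<close>
  ultimately show False using s assms(2) by (simp add: leads_def)
qed

lemma irreducible_tau:
  fixes p :: "('m, 'k::comm_ring_1) mpoly"
  assumes "irreducible p"
  shows "irreducible (tau v p)"
proof (rule irreducibleI)
  have inv: "tau (- v) (tau v q) = q" for q :: "('m, 'k) mpoly" by simp
  have unit: "tau w q dvd 1 \<longleftrightarrow> q dvd 1" for w and q :: "('m, 'k) mpoly"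
    using unital_hom_dvd[OF unital_hom_tau, of q 1 w]
      unital_hom_dvd[OF unital_hom_tau, of "tau w q" 1 "- w"] by (auto simp: tau_hom)
  show "tau v p \<noteq> 0" using assms inv[of p] by (metis irreducible_def tau_hom(1))
  show "\<not> tau v p dvd 1" using assms unit by (simp add: irreducible_def)
  fix a b assume "tau v p = a * b"
  then have "p = tau (- v) a * tau (- v) b" using inv[of p] by (simp add: tau_hom)
  then show "a dvd 1 \<or> b dvd 1" using irreducibleD[OF assms] unit by metis
qed

lemma Irr_tau_iff:
  fixes q :: "('m, 'k::comm_ring_1) mpoly"
  shows "tau v q \<in> Irr r \<longleftrightarrow> q \<in> Irr r"
proof -
  have "tau w q \<in> Irr r" if "q \<in> Irr r" for w and q :: "('m, 'k) mpoly"
    using that monic_tau irreducible_tau by (auto simp: Irr_def)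
  from this[of q v] this[of "tau v q" "- v"] show ?thesis by auto
qed

end

section \<open>Gauss's lemma without fractions\<close>

text \<open>
  A fraction-free form of Gauss's lemma: \<open>A\<close> plays the role of \<open>B[X]\<close>, with degree \<open>D\<close> in \<open>X\<close> and leading
  coefficient \<open>lc\<close>; \<open>N\<close> is a total degree.
\<close>
locale gauss_extension =
  fixes A B :: "'a::comm_ring_1 set" and X :: 'a
    and D :: "'a \<Rightarrow> nat" and lc :: "'a \<Rightarrow> 'a" and N :: "'a \<Rightarrow> nat"
  assumes no_zero_div: "a * b = 0 \<Longrightarrow> a = 0 \<or> b = 0"
    and A_mult: "a \<in> A \<Longrightarrow> b \<in> A \<Longrightarrow> a * b \<in> A"
    and A_diff: "a \<in> A \<Longrightarrow> b \<in> A \<Longrightarrow> a - b \<in> A"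
    and A_factor: "a * b \<in> A \<Longrightarrow> a * b \<noteq> 0 \<Longrightarrow> a \<in> A"
    and B_mult: "a \<in> B \<Longrightarrow> b \<in> B \<Longrightarrow> a * b \<in> B"
    and B_factor: "a * b \<in> B \<Longrightarrow> a * b \<noteq> 0 \<Longrightarrow> a \<in> B"
    and B_1: "1 \<in> B"
    and B_subset_A: "B \<subseteq> A"
    and X_in_A: "X \<in> A"
    and X_nonzero: "X \<noteq> 0"
    and D_mult: "a \<noteq> 0 \<Longrightarrow> b \<noteq> 0 \<Longrightarrow> D (a * b) = D a + D b"
    and lc_mult: "a \<noteq> 0 \<Longrightarrow> b \<noteq> 0 \<Longrightarrow> lc (a * b) = lc a * lc b"
    and lc_in_B: "a \<in> A \<Longrightarrow> lc a \<in> B"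
    and lc_nonzero: "a \<noteq> 0 \<Longrightarrow> lc a \<noteq> 0"
    and D_B: "b \<in> B \<Longrightarrow> D b = 0"
    and lc_B: "b \<in> B \<Longrightarrow> lc b = b"
    and D_0_in_B: "a \<in> A \<Longrightarrow> D a = 0 \<Longrightarrow> a \<in> B"
    and D_X: "D X = 1"
    and lc_X: "lc X = 1"
    and D_diff: "a \<noteq> 0 \<Longrightarrow> b \<noteq> 0 \<Longrightarrow> D a = D b \<Longrightarrow> lc a = lc b \<Longrightarrow> a \<noteq> b \<Longrightarrow> D (a - b) < D a"
    and N_mult: "a \<noteq> 0 \<Longrightarrow> b \<noteq> 0 \<Longrightarrow> N (a * b) = N a + N b"
    and N_0_unit: "a \<noteq> 0 \<Longrightarrow> N a = 0 \<Longrightarrow> a dvd 1"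
    and B_prime: "irreducible p \<Longrightarrow> p \<in> B \<Longrightarrow> a \<in> B \<Longrightarrow> b \<in> B \<Longrightarrow> p dvd a * b \<Longrightarrow> p dvd a \<or> p dvd b"
begin

lemma mult_nonzero: "a \<noteq> 0 \<Longrightarrow> b \<noteq> 0 \<Longrightarrow> a * b \<noteq> (0::'a)"
  using no_zero_div by blast

lemma cancel: "(c::'a) * a = c * b \<Longrightarrow> c \<noteq> 0 \<Longrightarrow> a = b"
  using no_zero_div[of c "a - b"] by (simp add: right_diff_distrib)

lemma A_0: "0 \<in> A"
  using A_diff[OF X_in_A X_in_A] by simp

lemma A_1: "1 \<in> A"
  using B_1 B_subset_A by blast

lemma A_add: "a \<in> A \<Longrightarrow> b \<in> A \<Longrightarrow> a + b \<in> A"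
  using A_diff[of a "0 - b"] A_diff[OF A_0, of b] by simp

lemma DX_power: "D (X ^ n) = n" and lcX_power: "lc (X ^ n) = 1" and X_power_in: "X ^ n \<in> A"
  and X_power_nonzero: "X ^ n \<noteq> 0"
proof -
  have "D (X ^ n) = n \<and> lc (X ^ n) = 1 \<and> X ^ n \<in> A \<and> X ^ n \<noteq> 0"
  proof (induction n)
    case 0
    then show ?case using D_B[OF B_1] lc_B[OF B_1] A_1 by simp
  next
    case (Suc n)
    then show ?case
      using D_mult[of X "X ^ n"] lc_mult[of X "X ^ n"] X_nonzero A_mult[OF X_in_A] mult_nonzero[of X "X ^ n"]
      by (simp add: D_X lc_X)
  qed
  then show "D (X ^ n) = n" "lc (X ^ n) = 1" "X ^ n \<in> A" "X ^ n \<noteq> 0" by auto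
qed

text \<open>\<open>N\<close> is additive and positive on nonzero nonunits, so it drops when passing
  to a proper factor.\<close>

lemma irreducible_factor_exists:
  "(b::'a) \<noteq> 0 \<Longrightarrow> \<not> b dvd 1 \<Longrightarrow> \<exists>p. irreducible p \<and> p dvd b"
proof (induction "N b" arbitrary: b rule: less_induct)
  case less
  show ?case
  proof (cases "irreducible b")
    case False
    then obtain a c where ac: "b = a * c" "\<not> a dvd 1" "\<not> c dvd 1"
      using less.prems by (auto simp: irreducible_def)
    then have nz: "a \<noteq> 0" "c \<noteq> 0" using less.prems by auto
    then have "N a < N b" using ac N_mult[OF nz] N_0_unit[of c] by auto
    then obtain p where "irreducible p" "p dvd a" using less.hyps nz ac by blast
    then show ?thesis using ac by auto
  qed auto
qed

lemma N_irreducible_pos: "irreducible p \<Longrightarrow> 0 < N p"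
  using N_0_unit[of p] by (auto simp: irreducible_def)

lemma remove_leading_term:
  assumes "p \<in> B" "g \<in> A" "g \<noteq> 0" "p dvd lc g"
  obtains g' where "g' \<in> A" "p dvd g - g'" "g' = 0 \<or> D g' < D g"
proof -
  define t where "t = lc g * X ^ D g"
  have B: "lc g \<in> B" and nz: "lc g \<noteq> 0" using assms lc_in_B lc_nonzero by auto
  have tA: "t \<in> A" using B B_subset_A A_mult X_power_in unfolding t_def by blast
  have tnz: "t \<noteq> 0" unfolding t_def using nz X_power_nonzero mult_nonzero by blast
  have Dt: "D t = D g" unfolding t_def using D_mult[OF nz X_power_nonzero] D_B[OF B] DX_power by simp
  have lt: "lc t = lc g" unfolding t_def using lc_mult[OF nz X_power_nonzero] lc_B[OF B] lcX_power by simp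
  show ?thesis
  proof (rule that[of "g - t"])
    show "g - t \<in> A" using A_diff assms tA by blast
    show "p dvd g - (g - t)" using assms(4) by (simp add: t_def)
    show "g - t = 0 \<or> D (g - t) < D g"
      using D_diff[OF assms(3) tnz] Dt lt by auto
  qed
qed

text \<open>Comparing leading coefficients, \<open>p\<close> divides \<open>lc g * lc h\<close>,
  hence one of the two by primality in \<open>B\<close>; that leading term is removed modulo
  \<open>p\<close> and the sum of the degrees drops.\<close>

lemma B_prime_in_A:
  assumes "irreducible p" "p \<in> B" "g \<in> A" "h \<in> A" "p dvd g * h"
  shows "p dvd g \<or> p dvd h"
  using assms(3-5)
proof (induction "D g + D h" arbitrary: g h rule: less_induct)
  case less
  show ?case
  proof (cases "g = 0 \<or> h = 0")
    case False
    then have nz: "g \<noteq> 0" "h \<noteq> 0" by auto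
    obtain c where c: "g * h = p * c" using less.prems by (auto elim: dvdE)
    have "c \<noteq> 0" "p \<noteq> 0" using c mult_nonzero[OF nz] by auto
    then have "lc g * lc h = p * lc c"
      using lc_mult[OF nz] lc_mult[of p c] lc_B[OF assms(2)] c by simp
    then have "p dvd lc g \<or> p dvd lc h"
      using B_prime[OF assms(1,2) lc_in_B lc_in_B] less.prems by (metis dvd_triv_left)
    then show ?thesis
    proof
      assume "p dvd lc g"
      then obtain g' where g': "g' \<in> A" "p dvd g - g'" "g' = 0 \<or> D g' < D g"
        using remove_leading_term[OF assms(2) less.prems(1) nz(1)] by blast
      have "g' * h = g * h - (g - g') * h" by (simp add: algebra_simps)
      then have "p dvd g' * h" using less.prems g' by (metis dvd_diff dvd_mult2)
      then have "p dvd g' \<or> p dvd h" using g' less.hyps[of g' h] less.prems by auto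
      moreover have "g = (g - g') + g'" by simp
      ultimately show ?thesis using g'(2) dvd_add by metis
    next
      assume "p dvd lc h"
      then obtain h' where h': "h' \<in> A" "p dvd h - h'" "h' = 0 \<or> D h' < D h"
        using remove_leading_term[OF assms(2) less.prems(2) nz(2)] by blast
      have "g * h' = g * h - g * (h - h')" by (simp add: algebra_simps)
      then have "p dvd g * h'" using less.prems h' by (metis dvd_diff dvd_mult)
      then have "p dvd g \<or> p dvd h'" using h' less.hyps[of g h'] less.prems by auto
      moreover have "h = (h - h') + h'" by simp
      ultimately show ?thesis using h'(2) dvd_add by metis
    qed
  qed auto
qed

text \<open>Expresses that the content is a unit, without gcds in \<open>B\<close>.\<close>

definition primitive :: "'a \<Rightarrow> bool" where
  "primitive f \<longleftrightarrow> (\<forall>p\<in>B. irreducible p \<longrightarrow> \<not> p dvd f)"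

text \<open>If \<open>c * g = f * h\<close>, an irreducible factor \<open>p\<close> of
  \<open>c\<close> is prime in \<open>A\<close> and does not divide \<open>f\<close>, so it divides
  \<open>h\<close> and cancels. The factors of \<open>c\<close> are used up one by one, as measured
  by \<open>N c\<close>.\<close>

lemma primitive_dvd_cancel:
  assumes "primitive f" "f \<in> A" "g \<in> A" "c \<in> B" "c \<noteq> 0" "f dvd c * g"
  shows "f dvd g"
  using assms(4-6)
proof (induction "N c" arbitrary: c rule: less_induct)
  case less
  show ?case
  proof (cases "g = 0 \<or> c dvd 1")
    case True
    then show ?thesis
    proof
      assume "c dvd 1"
      then obtain w where "1 = c * w" by (auto elim: dvdE)
      then have "g = w * (c * g)" by (metis mult.assoc mult.commute mult_1)
      then show ?thesis using less.prems by (metis dvd_mult)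
    qed auto
  next
    case False
    obtain p where p: "irreducible p" "p dvd c" using irreducible_factor_exists False less.prems by blast
    obtain c' where c': "c = p * c'" using p by (auto elim: dvdE)
    have nz: "p \<noteq> 0" "c' \<noteq> 0" using c' less.prems by auto
    have pB: "p \<in> B" using c' less.prems B_factor by blast
    have c'B: "c' \<in> B" using c' less.prems B_factor[of c' p] by (simp add: mult.commute)
    obtain h where h: "c * g = f * h" using less.prems by (auto elim: dvdE)
    \<comment> \<open>Primality of \<open>p\<close> is available only within \<open>A\<close>, so
      the cofactor \<open>h\<close> must first be placed there.\<close>
    have "h * f \<noteq> 0" using h False less.prems mult_nonzero[of c g] by (simp add: mult.commute)
    moreover have "h * f \<in> A" using h less.prems B_subset_A A_mult[of c g] assms by (auto simp: mult.commute)
    ultimately have "h \<in> A" using A_factor by blast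
    moreover have "p dvd f * h" using h c' by (metis dvd_triv_left mult.assoc)
    ultimately have "p dvd h" using B_prime_in_A[OF p(1) pB assms(2)] assms(1) p pB primitive_def by blast
    then obtain h' where h': "h = p * h'" by (auto elim: dvdE)
    have "p * (c' * g) = p * (f * h')" using h h' c' by (simp add: mult_ac)
    then have "c' * g = f * h'" using cancel nz by blast
    then have "f dvd c' * g" by simp
    moreover have "N c' < N c" using c' N_mult[OF nz] N_irreducible_pos[OF p(1)] by simp
    ultimately show ?thesis using less.hyps c'B nz by blast
  qed
qed

text \<open>Irreducible elements of \<open>B\<close> are split off until none divides the rest;
  \<open>N\<close> makes this terminate.\<close>

lemma primitive_part_exists:
  "g \<in> A \<Longrightarrow> g \<noteq> 0 \<Longrightarrow> \<exists>e\<in>B. \<exists>d\<in>A. g = e * d \<and> e \<noteq> 0 \<and> primitive d"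
proof (induction "N g" arbitrary: g rule: less_induct)
  case less
  show ?case
  proof (cases "primitive g")
    case True
    then show ?thesis using less.prems B_1 by (intro bexI[of _ 1] bexI[of _ g]) auto
  next
    case False
    then obtain p where p: "p \<in> B" "irreducible p" "p dvd g" by (auto simp: primitive_def)
    then obtain g' where g': "g = p * g'" by (auto elim: dvdE)
    have nz: "p \<noteq> 0" "g' \<noteq> 0" using g' less.prems by auto
    have "g' \<in> A" using g' less.prems A_factor[of g' p] by (simp add: mult.commute)
    moreover have "N g' < N g" using g' N_mult[OF nz] N_irreducible_pos[OF p(2)] by simp
    ultimately obtain e d where "e \<in> B" "d \<in> A" "g' = e * d" "e \<noteq> 0" "primitive d"
      using less.hyps nz by blast
    then show ?thesis using g' p B_mult[of p e] mult_nonzero[of p e] nz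
      by (intro bexI[of _ "p * e"] bexI[of _ d]) (auto simp: mult_ac)
  qed
qed

lemma D_unit:
  assumes "u dvd 1"
  shows "D u = 0"
proof -
  obtain w where w: "1 = u * w" using assms by (auto elim: dvdE)
  then have "u \<noteq> 0" "w \<noteq> 0" by auto
  then have "D u + D w = D 1" using w D_mult by metis
  then show ?thesis using D_B[OF B_1] by simp
qed

text \<open>An irreducible divisor in \<open>B\<close> would leave a unit as cofactor, giving
  \<open>q\<close> degree 0.\<close>

lemma irreducible_primitive:
  assumes "irreducible q" "D q \<noteq> 0"
  shows "primitive q"
  unfolding primitive_def
proof (intro ballI impI notI)
  fix p assume p: "p \<in> B" "irreducible p" "p dvd q"
  then obtain u where u: "q = p * u" by (auto elim: dvdE)
  then have "u dvd 1" using irreducibleD[OF assms(1) u] p by (auto simp: irreducible_def)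
  moreover have "p \<noteq> 0" "u \<noteq> 0" using u assms by (auto simp: irreducible_def)
  ultimately have "D q = 0" using u D_mult D_unit D_B p by simp
  then show False using assms by simp
qed

text \<open>Euclid's argument with pseudo-division instead of fractions: the primitive part
  \<open>d1\<close> of a least-degree element of the ideal of \<open>A\<close> generated by
  \<open>q\<close> and \<open>g\<close> divides both. As \<open>q\<close> is irreducible,
  \<open>d1\<close> is a unit, which gives \<open>q dvd h\<close>, or an associate of
  \<open>q\<close>, which gives \<open>q dvd g\<close>.\<close>

lemma irreducible_prime_in_A:
  assumes q: "irreducible q" "q \<in> A" and g: "g \<in> A" and h: "h \<in> A" and dvd: "q dvd g * h"
  shows "q dvd g \<or> q dvd h"
proof (cases "D q = 0")
  case True
  then show ?thesis using B_prime_in_A D_0_in_B assms by blast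
next
  case False
  have prim: "primitive q" using irreducible_primitive q False by blast
  have q0: "q \<noteq> 0" using q by (simp add: irreducible_def)
  define J where "J = {a * q + b * g | a b. a \<in> A \<and> b \<in> A}"
  have JA: "J \<subseteq> A" using A_add A_mult q g by (auto simp: J_def)
  have "q = 1 * q + 0 * g" "g = 0 * q + 1 * g" by simp_all
  then have qJ: "q \<in> J" and gJ: "g \<in> J"
    using A_0 A_1 unfolding J_def by blast+
  have Jdiff: "x - y \<in> J" if xy: "x \<in> J" "y \<in> J" for x y
  proof -
    obtain a b a' b' where "x = a * q + b * g" "y = a' * q + b' * g" and A: "a \<in> A" "b \<in> A" "a' \<in> A" "b' \<in> A"
      using xy by (auto simp: J_def)
    then have "x - y = (a - a') * q + (b - b') * g" by (simp add: algebra_simps)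
    then show ?thesis using A A_diff unfolding J_def by blast
  qed
  have Jmult: "s * x \<in> J" if sx: "s \<in> A" "x \<in> J" for s x
  proof -
    obtain a b where "x = a * q + b * g" and A: "a \<in> A" "b \<in> A"
      using sx by (auto simp: J_def)
    then have "s * x = (s * a) * q + (s * b) * g" by (simp add: algebra_simps)
    then show ?thesis using A A_mult sx unfolding J_def by blast
  qed
  obtain d0 where d0: "d0 \<in> J" "d0 \<noteq> 0" and min: "\<And>f. f \<in> J \<Longrightarrow> f \<noteq> 0 \<Longrightarrow> D d0 \<le> D f"
    using ex_has_least_nat[of "\<lambda>f. f \<in> J \<and> f \<noteq> 0" q D] qJ q0 by blast
  have lc0: "lc d0 \<in> B" "lc d0 \<in> A" "lc d0 \<noteq> 0"
    using d0 JA lc_in_B lc_nonzero B_subset_A by auto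
  \<comment> \<open>Pseudo-division: \<open>lc d0 * f\<close> minus a suitable multiple of
    \<open>d0\<close> loses its leading term and stays in \<open>J\<close>, so the degree induction
    applies.\<close>
  have pdiv: "\<exists>c\<in>B. c \<noteq> 0 \<and> (\<exists>s\<in>A. c * f = s * d0)" if "f \<in> J" for f
    using that
  proof (induction "D f" arbitrary: f rule: less_induct)
    case less
    show ?case
    proof (cases "f = 0")
      case True
      then show ?thesis using B_1 A_0 by (intro bexI[of _ 1]) (auto intro!: bexI[of _ 0])
    next
      case False
      \<comment> \<open>The truncated subtraction is exact because \<open>D d0\<close> is minimal on
        \<open>J\<close>.\<close>
      define m where "m = lc f * X ^ (D f - D d0)"
      have lcf: "lc f \<in> B" "lc f \<in> A" "lc f \<noteq> 0"
        using less.prems JA lc_in_B lc_nonzero B_subset_A False by auto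
      have mA: "m \<in> A" unfolding m_def using lcf A_mult X_power_in by blast
      have m0: "m \<noteq> 0" unfolding m_def using lcf mult_nonzero X_power_nonzero by blast
      have Dm: "D m = D f - D d0" "lc m = lc f"
        unfolding m_def using D_mult[OF lcf(3) X_power_nonzero] lc_mult[OF lcf(3) X_power_nonzero]
          D_B[OF lcf(1)] lc_B[OF lcf(1)] DX_power lcX_power by auto
      define f' where "f' = lc d0 * f - m * d0"
      have "f' \<in> J" unfolding f'_def using Jdiff Jmult lc0 mA d0 less.prems by blast
      have D1: "D (lc d0 * f) = D f" "lc (lc d0 * f) = lc d0 * lc f"
        using D_mult[OF lc0(3) False] lc_mult[OF lc0(3) False] D_B[OF lc0(1)] lc_B[OF lc0(1)] by auto
      have D2: "D (m * d0) = D f" "lc (m * d0) = lc d0 * lc f"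
        using D_mult[OF m0 d0(2)] lc_mult[OF m0 d0(2)] Dm min[OF less.prems False] by (auto simp: mult.commute)
      show ?thesis
      proof (cases "f' = 0")
        case True
        then have "lc d0 * f = m * d0" by (simp add: f'_def)
        then show ?thesis using lc0 mA by blast
      next
        case False
        have "D f' < D (lc d0 * f)"
          unfolding f'_def
        proof (rule D_diff)
          show "lc d0 * f \<noteq> 0" "m * d0 \<noteq> 0" using mult_nonzero lc0 \<open>f \<noteq> 0\<close> m0 d0 by auto
          show "lc d0 * f \<noteq> m * d0" using False by (simp add: f'_def)
        qed (use D1 D2 in auto)
        then obtain c s where c: "c \<in> B" "c \<noteq> 0" "s \<in> A" "c * f' = s * d0"
          using less.hyps[of f'] \<open>f' \<in> J\<close> D1 by auto
        then have "(c * lc d0) * f = (s + c * m) * d0" by (simp add: f'_def algebra_simps)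
        moreover have "s + c * m \<in> A" using c mA A_add A_mult B_subset_A by blast
        ultimately show ?thesis
          using c lc0 B_mult mult_nonzero by blast
      qed
    qed
  qed
  obtain e d1 where ed: "e \<in> B" "d1 \<in> A" "d0 = e * d1" "e \<noteq> 0" "primitive d1"
    using primitive_part_exists d0 JA by blast
  \<comment> \<open>\<open>d1\<close> divides \<open>c * f\<close>, and its primitivity cancels
    \<open>c\<close>.\<close>
  have d1: "d1 dvd f" if f: "f \<in> J" for f
  proof -
    obtain c s where "c \<in> B" "c \<noteq> 0" "c * f = s * d0" using pdiv[OF f] by blast
    then show ?thesis using primitive_dvd_cancel[OF ed(5,2), of f c] ed(3) f JA by auto
  qed
  obtain t where t: "q = d1 * t" using d1[OF qJ] by (auto elim: dvdE)
  show ?thesis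
  proof (cases "d1 dvd 1")
    case True
    then obtain w where w: "1 = d1 * w" by (auto elim: dvdE)
    obtain a b where ab: "d0 = a * q + b * g" using d0 by (auto simp: J_def)
    \<comment> \<open>A unit \<open>d1\<close> makes \<open>e\<close> a combination of
      \<open>q\<close> and \<open>g\<close>, so \<open>q\<close> divides \<open>e * h\<close>;
      primitivity of \<open>q\<close> then removes \<open>e\<close>.\<close>
    have "e = d0 * w" using w ed(3) by (simp add: mult.assoc)
    then have "e * h = q * (a * w * h) + (g * h) * (b * w)" using ab by (simp add: algebra_simps)
    then have "q dvd e * h" using dvd by simp
    then show ?thesis using primitive_dvd_cancel[OF prim q(2) h ed(1,4)] by blast
  next
    case False
    then have "t dvd 1" using irreducibleD[OF q(1) t] by blast
    then obtain w where w: "1 = t * w" by (auto elim: dvdE)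
    then have "d1 = q * w" using t by (simp add: mult.assoc)
    then have "q dvd d1" by simp
    then show ?thesis using d1[OF gJ] dvd_trans by blast
  qed
qed

end

section \<open>Irreducible polynomials are prime\<close>

text \<open>Subrings in fewer variables are kept inside one type, so that the induction over
  variables changes only a set.\<close>

definition polys_in :: "'m set \<Rightarrow> ('m, 'k::comm_ring_1) mpoly set" where
  "polys_in V = {p. \<forall>s\<in>Poly_Mapping.keys p. Poly_Mapping.keys s \<subseteq> V}"

lemma polys_in_mono: "V \<subseteq> W \<Longrightarrow> polys_in V \<subseteq> polys_in W"
  by (auto simp: polys_in_def)

lemma polys_in_UNIV: "p \<in> polys_in UNIV"
  by (simp add: polys_in_def)

lemma Const_in_polys_in: "Const a \<in> polys_in V"
  by (auto simp: polys_in_def Const_def split: if_splits)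

lemma Var_in_polys_in: "j \<in> V \<Longrightarrow> Var j \<in> polys_in V"
  by (auto simp: polys_in_def Var_def)

lemma polys_in_add: "p \<in> polys_in V \<Longrightarrow> q \<in> polys_in V \<Longrightarrow> p + q \<in> polys_in V"
  using Poly_Mapping.keys_add[of p q] by (fastforce simp: polys_in_def)

lemma polys_in_uminus: "p \<in> polys_in V \<Longrightarrow> - p \<in> polys_in V"
  by (auto simp: polys_in_def in_keys_iff)

lemma polys_in_diff: "p \<in> polys_in V \<Longrightarrow> q \<in> polys_in V \<Longrightarrow> p - q \<in> polys_in V"
  using polys_in_add[OF _ polys_in_uminus, of p V q] by simp

lemma polys_in_mult:
  assumes "p \<in> polys_in V" "q \<in> polys_in V"
  shows "p * q \<in> polys_in V"
proof -
  have "Poly_Mapping.keys w \<subseteq> V" if w: "w \<in> Poly_Mapping.keys (p * q)" for w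
  proof -
    obtain s t where st: "w = s + t" "s \<in> Poly_Mapping.keys p" "t \<in> Poly_Mapping.keys q"
      using w keys_mult[of p q] by blast
    then have "Poly_Mapping.keys s \<subseteq> V" "Poly_Mapping.keys t \<subseteq> V"
      using assms by (auto simp: polys_in_def)
    then show ?thesis unfolding st(1) using Poly_Mapping.keys_add[of s t] by blast
  qed
  then show ?thesis by (simp add: polys_in_def)
qed

lemma polys_in_0: "0 \<in> polys_in V" and polys_in_1: "1 \<in> polys_in V"
  by (auto simp: polys_in_def)

lemma polys_in_sum: "(\<And>x. x \<in> S \<Longrightarrow> f x \<in> polys_in V) \<Longrightarrow> sum f S \<in> polys_in V"
  by (induction S rule: infinite_finite_induct) (auto simp: polys_in_0 polys_in_add)

lemma polys_in_empty_Const: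
  assumes "p \<in> polys_in {}"
  obtains a where "p = Const a"
proof -
  have "Poly_Mapping.keys p \<subseteq> {0}" using assms by (auto simp: polys_in_def)
  then have 0: "Poly_Mapping.lookup p s = 0" if "s \<noteq> 0" for s
    using that by (metis in_keys_iff singletonD subsetD)
  have "p = Const (Poly_Mapping.lookup p 0)"
    by (rule poly_mapping_eqI) (use 0 in \<open>auto simp: Const_def lookup_single when_def\<close>)
  then show ?thesis by (rule that)
qed

section \<open>Polynomials as univariate polynomials in one chosen variable\<close>

definition coeffs_in :: "'a::comm_ring_1 set \<Rightarrow> 'a poly set" where
  "coeffs_in B = {P. \<forall>i. coeff P i \<in> B}"

text \<open>\<open>expand x\<close> is the isomorphism of \<open>\<bbbk>[u]\<close> with the part of \<open>\<bbbk>[u][X]\<close> whose coefficients do not involve \<open>u\<^sub>x\<close>.\<close>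
definition expand :: "'m::finite \<Rightarrow> ('m, 'k::comm_ring_1) mpoly \<Rightarrow> ('m, 'k) mpoly poly" where
  "expand x = ev (\<lambda>a. [:Const a:]) (\<lambda>j. if j = x then [:0, 1:] else [:Var j:])"

lemma unital_hom_pCons: "unital_hom (\<lambda>a :: 'a::comm_ring_1. [:a:])"
  by (auto simp: unital_hom_def)

lemma unital_hom_pCons_Const: "unital_hom (\<lambda>a :: 'k::comm_ring_1. [:Const a :: ('m, 'k) mpoly:])"
  by (rule unital_hom_comp[OF unital_hom_pCons unital_hom_Const])

lemma unital_hom_expand: "unital_hom (expand x)"
  unfolding expand_def by (rule unital_hom_ev[OF unital_hom_pCons_Const])

lemmas expand_hom = unital_homD[OF unital_hom_expand] unital_hom_uminus[OF unital_hom_expand]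
  unital_hom_diff[OF unital_hom_expand]

lemma expand_Const: "expand x (Const a) = [:Const a:]"
  unfolding expand_def by (rule ev_Const[OF unital_hom_pCons_Const])

lemma expand_Var: "expand x (Var j) = (if j = x then [:0, 1:] else [:Var j:])"
  unfolding expand_def by (rule ev_Var[OF unital_hom_pCons_Const])

text \<open>Putting the variable back undoes the expansion, which also makes \<open>expand x\<close>
  injective.\<close>

lemma poly_expand: "poly (expand x p) (Var x) = p"
proof (rule hom_eqI[of "\<lambda>p. poly (expand x p) (Var x)" "\<lambda>p. p"])
  show "unital_hom (\<lambda>p. poly (expand x p) (Var x))"
    by (auto simp: unital_hom_def expand_hom)
qed (auto simp: unital_hom_id expand_Const expand_Var)

lemma expand_eq_0_iff: "expand x p = 0 \<longleftrightarrow> p = 0"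
  using poly_expand[of x p] by (auto simp: expand_hom)

lemma expand_polys_in:
  assumes "p \<in> polys_in V" "x \<notin> V"
  shows "expand x p = [:p:]"
proof -
  have "expand x p = ev (\<lambda>a. [:Const a:]) (\<lambda>j. [:Var j:]) p"
    unfolding expand_def ev_def
  proof (intro sum.cong refl arg_cong[of _ _ "(*) _"])
    fix s assume "s \<in> Poly_Mapping.keys p"
    then have "x \<notin> Poly_Mapping.keys s" using assms by (auto simp: polys_in_def)
    then have "Poly_Mapping.lookup s x = 0" by (simp add: in_keys_iff)
    then show "monom_ev (\<lambda>j. if j = x then [:0, 1:] else [:Var j:]) s = monom_ev (\<lambda>j. [:Var j:]) s"
      unfolding monom_ev_def by (intro prod.cong refl) auto
  qed
  also have "\<dots> = [:p:]"
    using hom_eq_ev[OF unital_hom_pCons, of p] by simp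
  finally show ?thesis .
qed

lemma coeffs_in_polys_in_mult:
  assumes "P \<in> coeffs_in (polys_in V)" "Q \<in> coeffs_in (polys_in V)"
  shows "P * Q \<in> coeffs_in (polys_in V)"
  using assms by (auto simp: coeffs_in_def coeff_mult intro!: polys_in_sum polys_in_mult)

text \<open>The set \<open>?C\<close> is closed under products and contains the images of constants
  and of variables in \<open>V\<close>; a variable outside \<open>V\<close> occurs in
  \<open>p\<close> with exponent 0 only.\<close>

lemma expand_coeffs_in:
  assumes "p \<in> polys_in V"
  shows "expand x p \<in> coeffs_in (polys_in (V - {x}))"
proof -
  let ?C = "coeffs_in (polys_in (V - {x})) :: ('a, 'b) mpoly poly set"
  have mult: "P * Q \<in> ?C" if "P \<in> ?C" "Q \<in> ?C" for P Q
    using that by (rule coeffs_in_polys_in_mult)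
  have const: "[:q:] \<in> ?C" if "q \<in> polys_in (V - {x})" for q
    using that by (auto simp: coeffs_in_def coeff_pCons polys_in_0 split: nat.split)
  have one: "1 \<in> ?C" using const[OF polys_in_1] by (simp add: one_pCons)
  have X: "[:0, 1:] \<in> ?C"
    by (auto simp: coeffs_in_def coeff_pCons polys_in_0 polys_in_1 split: nat.split)
  have power: "P ^ n \<in> ?C" if "P \<in> ?C" for P n
    by (induction n) (auto simp: one mult that simp del: coeff_1)
  have "monom_ev (\<lambda>j. if j = x then [:0, 1:] else [:Var j:]) s \<in> ?C" if s: "s \<in> Poly_Mapping.keys p" for s
  proof -
    have "(\<Prod>j\<in>J. (if j = x then [:0, 1:] else [:Var j:]) ^ Poly_Mapping.lookup s j) \<in> ?C" for J
    proof (induction J rule: infinite_finite_induct)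
      case (insert j J)
      have "(if j = x then [:0, 1:] else [:Var j:]) ^ Poly_Mapping.lookup s j \<in> ?C"
      proof (cases "j \<in> V")
        case True
        then show ?thesis using power X const[OF Var_in_polys_in, of j] by auto
      next
        case False
        then have "j \<notin> Poly_Mapping.keys s" using assms s by (auto simp: polys_in_def)
        then have "Poly_Mapping.lookup s j = 0" by (simp add: in_keys_iff)
        then show ?thesis using one by simp
      qed
      then show ?case using insert mult by simp
    qed (auto simp: one)
    then show ?thesis unfolding monom_ev_def .
  qed
  then have "[:Const (Poly_Mapping.lookup p s):] * monom_ev (\<lambda>j. if j = x then [:0, 1:] else [:Var j:]) s \<in> ?C"
    if "s \<in> Poly_Mapping.keys p" for s
    using that mult const[OF Const_in_polys_in] by blast
  then show ?thesis
    unfolding expand_def ev_def coeffs_in_def by (auto simp: coeff_sum intro!: polys_in_sum)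
qed

definition deg_in :: "'m::finite \<Rightarrow> ('m, 'k::comm_ring_1) mpoly \<Rightarrow> nat" where
  "deg_in x p = degree (expand x p)"

definition lc_in :: "'m::finite \<Rightarrow> ('m, 'k::comm_ring_1) mpoly \<Rightarrow> ('m, 'k) mpoly" where
  "lc_in x p = lead_coeff (expand x p)"

text \<open>A constant expansion equals its value at \<open>Var x\<close>, which is
  \<open>p\<close>, and its coefficient does not involve \<open>x\<close>.\<close>

lemma deg_in_0_polys_in:
  assumes "p \<in> polys_in V" "deg_in x p = 0"
  shows "p \<in> polys_in (V - {x})"
proof -
  obtain c where "expand x p = [:c:]" using assms(2) degree_eq_zeroE deg_in_def by metis
  then have "coeff (expand x p) 0 = p" using poly_expand[of x p] by auto
  moreover have "coeff (expand x p) 0 \<in> polys_in (V - {x})"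
    using expand_coeffs_in[OF assms(1), of x] by (simp only: coeffs_in_def mem_Collect_eq)
  ultimately show ?thesis by (simp only:)
qed

lemma deg_in_all_0_polys_in:
  assumes "\<And>x. x \<in> S \<Longrightarrow> deg_in x p = 0"
  shows "p \<in> polys_in (- S)"
proof -
  show ?thesis
    using finite[of S] assms
  proof (induction S rule: finite_induct)
    case (insert x S)
    have "- insert x S = - S - {x}" by blast
    then show ?case using deg_in_0_polys_in[of p "- S" x] insert by simp
  qed (simp add: polys_in_UNIV)
qed

lemma lc_in_nonzero: "p \<noteq> 0 \<Longrightarrow> lc_in x p \<noteq> 0"
  by (simp add: lc_in_def expand_eq_0_iff)

lemma deg_in_diff_less:
  assumes "deg_in x a = deg_in x b" "lc_in x a = lc_in x b" "a \<noteq> b"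
  shows "deg_in x (a - b) < deg_in x a"
proof -
  let ?P = "expand x a - expand x b"
  have "?P \<noteq> 0" using assms(3) expand_eq_0_iff[of x "a - b"] by (simp add: expand_hom)
  have le: "degree ?P \<le> degree (expand x a)"
    using degree_diff_le[of "expand x a" _ "expand x b"] assms(1) by (simp add: deg_in_def)
  have "coeff ?P (degree (expand x a)) = 0"
    using assms(1,2) by (simp add: deg_in_def lc_in_def)
  then have "degree ?P \<noteq> degree (expand x a)"
    using \<open>?P \<noteq> 0\<close> leading_coeff_0_iff by metis
  then show ?thesis using le by (simp add: deg_in_def expand_hom)
qed

text \<open>Not the usual total degree, but the sum of the partial degrees. It is additive on
  products over a domain, and a nonzero polynomial of value 0 is a constant.\<close>

definition total_deg :: "('m::finite, 'k::comm_ring_1) mpoly \<Rightarrow> nat" where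
  "total_deg p = (\<Sum>x\<in>UNIV. deg_in x p)"

lemma Const_unit: "(a::'k::field) \<noteq> 0 \<Longrightarrow> Const a dvd (1 :: ('m, 'k) mpoly)"
  using Const_hom(4)[of a "inverse a"] by (metis Const_hom(2) dvd_triv_left right_inverse)

section \<open>Degrees of products, and primality by induction on the set of variables\<close>

context
  fixes r :: "('m::finite \<Rightarrow>\<^sub>0 nat) rel"
  assumes mo: "monomial_order r"
begin

text \<open>The candidate top coefficient is a product of nonzero polynomials, hence nonzero, so the
  general bound on the degree is attained.\<close>

lemma deg_in_lc_in_mult:
  fixes p q :: "('m, 'k::idom) mpoly"
  assumes "p \<noteq> 0" "q \<noteq> 0"
  shows "deg_in x (p * q) = deg_in x p + deg_in x q" "lc_in x (p * q) = lc_in x p * lc_in x q"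
proof -
  let ?P = "expand x p" and ?Q = "expand x q"
  have c: "coeff (?P * ?Q) (degree ?P + degree ?Q) = lead_coeff ?P * lead_coeff ?Q"
    by (rule coeff_mult_degree_sum)
  have "lead_coeff ?P * lead_coeff ?Q \<noteq> 0"
    using mpoly_no_zero_divisors[OF mo] lc_in_nonzero[OF assms(1), of x] lc_in_nonzero[OF assms(2), of x]
    unfolding lc_in_def by blast
  then have "degree (?P * ?Q) = degree ?P + degree ?Q"
    using c le_degree[of "?P * ?Q"] degree_mult_le[of ?P ?Q] by (metis le_antisym)
  then show "deg_in x (p * q) = deg_in x p + deg_in x q" "lc_in x (p * q) = lc_in x p * lc_in x q"
    using c by (simp_all add: deg_in_def lc_in_def expand_hom)
qed

text \<open>For variables outside \<open>V\<close> the product has partial degree 0, and partial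
  degrees add up.\<close>

lemma polys_in_factor:
  fixes a b :: "('m, 'k::idom) mpoly"
  assumes "a * b \<in> polys_in V" "a * b \<noteq> 0"
  shows "a \<in> polys_in V"
proof -
  have nz: "a \<noteq> 0" "b \<noteq> 0" using assms(2) by auto
  have "deg_in x a = 0" if "x \<in> - V" for x
  proof -
    have "deg_in x (a * b) = 0"
      using expand_polys_in[OF assms(1)] that by (simp add: deg_in_def)
    then show ?thesis using deg_in_lc_in_mult(1)[OF nz, of x] by simp
  qed
  then show ?thesis using deg_in_all_0_polys_in[of "- V" a] by simp
qed

lemma total_deg_mult:
  fixes p q :: "('m, 'k::idom) mpoly"
  shows "p \<noteq> 0 \<Longrightarrow> q \<noteq> 0 \<Longrightarrow> total_deg (p * q) = total_deg p + total_deg q"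
  by (simp add: total_deg_def deg_in_lc_in_mult(1) sum.distrib)

lemma total_deg_0_unit:
  fixes p :: "('m, 'k::field) mpoly"
  assumes "p \<noteq> 0" "total_deg p = 0"
  shows "p dvd 1"
proof -
  have "p \<in> polys_in (- UNIV)"
    using assms(2) by (intro deg_in_all_0_polys_in) (simp add: total_deg_def)
  then obtain a where "p = Const a" using polys_in_empty_Const by auto
  then show ?thesis using assms(1) Const_unit Const_hom(1) by metis
qed

text \<open>With no variables, an irreducible element would be a nonzero constant, hence a unit.
  Adjoining \<open>x\<close> is an instance of \<open>gauss_extension\<close> over the polynomials
  in \<open>V\<close>.\<close>

lemma irreducible_prime_in_polys_in:
  fixes q :: "('m, 'k::field) mpoly"
  assumes "irreducible q" "q \<in> polys_in V" "a \<in> polys_in V" "b \<in> polys_in V" "q dvd a * b"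
  shows "q dvd a \<or> q dvd b"
  using finite[of V] assms
proof (induction V arbitrary: q a b rule: finite_induct)
  case empty
  then obtain c where c: "q = Const c" using polys_in_empty_Const by blast
  then have "c \<noteq> 0" using empty.prems(1) Const_hom(1) by (metis irreducible_def)
  then show ?case using empty.prems(1) c Const_unit by (auto simp: irreducible_def)
next
  case (insert x V)
  interpret gauss_extension "polys_in (insert x V) :: ('m, 'k) mpoly set" "polys_in V" "Var x"
    "deg_in x" "lc_in x" total_deg
  proof
    show "a = 0 \<or> b = 0" if "a * b = 0" for a b :: "('m, 'k) mpoly"
      using mpoly_no_zero_divisors[OF mo that] .
    show "lc_in x a \<in> polys_in V" if "a \<in> polys_in (insert x V)" for a :: "('m, 'k) mpoly"
      using expand_coeffs_in[OF that, of x] insert.hyps(2) by (simp add: coeffs_in_def lc_in_def)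
    show "deg_in x b = 0" "lc_in x b = b" if "b \<in> polys_in V" for b :: "('m, 'k) mpoly"
      using expand_polys_in[OF that insert.hyps(2)] by (simp_all add: deg_in_def lc_in_def)
    show "a \<in> polys_in V" if "a \<in> polys_in (insert x V)" "deg_in x a = 0" for a :: "('m, 'k) mpoly"
      using deg_in_0_polys_in[OF that] insert.hyps(2) by simp
    show "deg_in x (Var x :: ('m, 'k) mpoly) = 1" "lc_in x (Var x :: ('m, 'k) mpoly) = 1"
      by (simp_all add: deg_in_def lc_in_def expand_Var)
    show "Var x \<noteq> (0 :: ('m, 'k) mpoly)"
      using expand_Var[of x x] expand_hom(1)[of x] by (metis pCons_eq_0_iff one_neq_zero)
    show "deg_in x (a - b) < deg_in x a" if "deg_in x a = deg_in x b" "lc_in x a = lc_in x b" "a \<noteq> b"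
      for a b :: "('m, 'k) mpoly"
      using deg_in_diff_less[OF that] .
    show "p dvd a \<or> p dvd b" if "irreducible p" "p \<in> polys_in V" "a \<in> polys_in V" "b \<in> polys_in V" "p dvd a * b"
      for p a b :: "('m, 'k) mpoly"
      using insert.IH that by blast
  qed (use polys_in_mono[of V "insert x V"] in \<open>auto simp: polys_in_mult polys_in_diff polys_in_1 Var_in_polys_in
      deg_in_lc_in_mult lc_in_nonzero total_deg_mult
      intro: total_deg_0_unit polys_in_factor\<close>)
  show ?case using irreducible_prime_in_A insert.prems by blast
qed

theorem irreducible_mpoly_prime:
  fixes q :: "('m, 'k::field) mpoly"
  shows "irreducible q \<Longrightarrow> q dvd a * b \<Longrightarrow> q dvd a \<or> q dvd b"
  using irreducible_prime_in_polys_in[of q UNIV a b] polys_in_UNIV by blast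

end

section \<open>Monic factorization and its multiplicities\<close>

context
  fixes r :: "('m::finite \<Rightarrow>\<^sub>0 nat) rel"
  assumes mo: "monomial_order r"
begin

text \<open>The leading monomials of \<open>p\<close> and its inverse add up to 0, so both are 0,
  the least monomial, and \<open>p\<close> is constant.\<close>

lemma monic_unit_eq_1:
  fixes p :: "('m, 'k::field) mpoly"
  assumes "monic r p" "p dvd 1"
  shows "p = 1"
proof -
  obtain w where w: "1 = p * w" using assms(2) by (auto elim: dvdE)
  obtain s where s: "leads r s 1 p" using assms(1) monic_iff_leads[OF mo] by blast
  have "w \<noteq> 0" using w by auto
  then obtain t d where t: "d \<noteq> 0" "leads r t d w" using leads_exists[OF mo] by blast
  have "leads r (s + t) (1 * d) 1" using leads_mult[OF mo s t(2)] w by simp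
  then have "0 = s + t \<and> (1::'k) = 1 * d" using leads_unique[OF mo leads_1[OF mo]] t(1) by force
  then have "0 = s" using mo_add_eqD[OF mo mo_0[OF mo, of s] mo_0[OF mo, of t]] by simp
  then have "Poly_Mapping.keys p \<subseteq> {0}" "Poly_Mapping.lookup p 0 = 1"
    using s mo_antisym[OF mo _ mo_0[OF mo]] by (auto simp: leads_def)
  then have "Poly_Mapping.lookup p u = (if u = 0 then 1 else 0)" for u
    by (auto simp del: not_in_keys_iff_lookup_eq_zero simp: not_in_keys_iff_lookup_eq_zero[symmetric])
  then show ?thesis by (intro poly_mapping_eqI) (simp add: lookup_one when_def)
qed

lemma monic_scale_exists:
  fixes p :: "('m, 'k::field) mpoly"
  assumes "p \<noteq> 0"
  obtains c where "c \<noteq> 0" "monic r (Const c * p)"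
proof -
  obtain s a where s: "a \<noteq> 0" "leads r s a p" using leads_exists[OF mo assms] by blast
  have "leads r (0 + s) (inverse a * a) (Const (inverse a) * p)"
    using leads_mult[OF mo leads_Const[OF mo] s(2)] .
  then have "monic r (Const (inverse a) * p)"
    using s(1) monic_iff_leads[OF mo] by auto
  then show ?thesis by (rule that[rotated]) (simp add: s(1))
qed

lemma monic_factorization_exists:
  fixes p :: "('m, 'k::field) mpoly"
  shows "monic r p \<Longrightarrow> \<exists>M. set_mset M \<subseteq> Irr r \<and> prod_mset M = p"
proof (induction "total_deg p" arbitrary: p rule: less_induct)
  case less
  then have p0: "p \<noteq> 0" by (simp add: monic_def)
  consider "p dvd 1" | "irreducible p" | "\<not> p dvd 1" "\<not> irreducible p" by blast
  then show ?case
  proof cases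
    case 1
    then show ?thesis using monic_unit_eq_1 less.prems by (intro exI[of _ "{#}"]) auto
  next
    case 2
    then show ?thesis using less.prems by (intro exI[of _ "{#p#}"]) (auto simp: Irr_def)
  next
    case 3
    then obtain a b where ab: "p = a * b" "\<not> a dvd 1" "\<not> b dvd 1"
      using p0 by (auto simp: irreducible_def)
    have "a \<noteq> 0" using ab p0 by auto
    then obtain c where c: "c \<noteq> 0" "monic r (Const c * a)" using monic_scale_exists by blast
    \<comment> \<open>The inverse scalar moves to the second factor, which is then monic because the
      product and the first factor are.\<close>
    define a' b' where "a' = Const c * a" and "b' = Const (inverse c) * b"
    have "Const c * Const (inverse c) = (1 :: ('m, 'k) mpoly)"
      using c(1) Const_hom(4)[of c "inverse c"] by (metis Const_hom(2) right_inverse)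
    then have "p = (Const c * Const (inverse c)) * (a * b)" by (simp add: ab(1))
    then have p: "p = a' * b'" by (simp only: a'_def b'_def mult_ac)
    have nu: "\<not> a' dvd 1" "\<not> b' dvd 1"
      using ab(2,3) dvd_trans[of a a' 1] dvd_trans[of b b' 1] unfolding a'_def b'_def by auto
    have nz: "a' \<noteq> 0" "b' \<noteq> 0" using p p0 by auto
    have mon: "monic r a'" "monic r b'"
      using c(2) monic_mult_leftD[OF mo, of a' b'] less.prems p by (auto simp: a'_def)
    have "total_deg a' \<noteq> 0" "total_deg b' \<noteq> 0"
      using total_deg_0_unit[OF mo] nu nz by blast+
    then have "total_deg a' < total_deg p" "total_deg b' < total_deg p"
      using total_deg_mult[OF mo nz] p by auto
    then obtain M N where "set_mset M \<subseteq> Irr r" "prod_mset M = a'" "set_mset N \<subseteq> Irr r" "prod_mset N = b'"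
      using less.hyps mon by meson
    then show ?thesis using p by (intro exI[of _ "M + N"]) auto
  qed
qed

text \<open>The cofactor is a monic unit, hence 1: monicity selects one element from each class of
  associates.\<close>

lemma Irr_dvd_Irr:
  fixes q q' :: "('m, 'k::field) mpoly"
  assumes "q \<in> Irr r" "q' \<in> Irr r" "q dvd q'"
  shows "q' = q"
proof -
  obtain u where u: "q' = q * u" using assms(3) by (auto elim: dvdE)
  have "\<not> q dvd 1" using assms(1) by (simp add: Irr_def irreducible_def)
  then have "u dvd 1" using irreducibleD[of q' q u] u assms(2) by (auto simp: Irr_def)
  moreover have "monic r u" using monic_mult_leftD[OF mo, of q u] u assms by (auto simp: Irr_def)
  ultimately have "u = 1" by (intro monic_unit_eq_1)
  then show ?thesis using u by simp
qed

lemma Irr_dvd_prod_mset: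
  fixes q :: "('m, 'k::field) mpoly"
  assumes "q \<in> Irr r" "q dvd prod_mset N"
  shows "\<exists>q'\<in>#N. q dvd q'"
  using assms(2)
proof (induction N)
  case empty
  then show ?case using assms(1) by (simp add: Irr_def irreducible_def)
next
  case (add x N)
  then show ?case using irreducible_mpoly_prime[OF mo, of q x "prod_mset N"] assms(1) by (auto simp: Irr_def)
qed

lemma monic_factorization_unique:
  fixes M N :: "('m, 'k::field) mpoly multiset"
  shows "set_mset M \<subseteq> Irr r \<Longrightarrow> set_mset N \<subseteq> Irr r \<Longrightarrow> prod_mset M = prod_mset N \<Longrightarrow> M = N"
proof (induction M arbitrary: N)
  case empty
  have "q \<notin># N" for q
  proof
    assume q: "q \<in># N"
    then have "q dvd 1" using dvd_prod_mset[of q N] empty by simp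
    then show False using q empty.prems by (auto simp: Irr_def irreducible_def)
  qed
  then show ?case by (metis multiset_nonemptyE)
next
  case (add q M)
  then have q: "q \<in> Irr r" by simp
  have "q dvd prod_mset N" unfolding add.prems(3)[symmetric] by simp
  then obtain q' where q': "q' \<in># N" "q dvd q'" using Irr_dvd_prod_mset q by blast
  then have "q' = q" using Irr_dvd_Irr q add.prems(2) by blast
  then obtain N' where N': "N = add_mset q N'" using q'(1) by (metis mset_add)
  have "q * (prod_mset M - prod_mset N') = 0"
    using add.prems(3) N' by (simp add: right_diff_distrib)
  then have "prod_mset M = prod_mset N'"
    using mpoly_no_zero_divisors[OF mo, of q "prod_mset M - prod_mset N'"] q by (auto simp: Irr_def monic_def)
  then show ?case using add N' by simp
qed

text \<open>Well defined for monic arguments by the existence and uniqueness above; its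
  \<open>count\<close> is the multiplicity function.\<close>

definition monic_factors :: "('m, 'k::field) mpoly \<Rightarrow> ('m, 'k) mpoly multiset" where
  "monic_factors p = (THE M. set_mset M \<subseteq> Irr r \<and> prod_mset M = p)"

lemma monic_factors_eqI: "set_mset M \<subseteq> Irr r \<Longrightarrow> prod_mset M = p \<Longrightarrow> monic_factors p = M"
  unfolding monic_factors_def by (rule the_equality) (auto intro: monic_factorization_unique)

lemma
  assumes "monic r p"
  shows monic_factors_Irr: "set_mset (monic_factors p) \<subseteq> Irr r"
    and prod_mset_monic_factors: "prod_mset (monic_factors p) = p"
proof -
  obtain M where M: "set_mset M \<subseteq> Irr r" "prod_mset M = p"
    using monic_factorization_exists[OF assms] by blast
  then have "monic_factors p = M" by (rule monic_factors_eqI)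
  then show "set_mset (monic_factors p) \<subseteq> Irr r" "prod_mset (monic_factors p) = p" using M by auto
qed

lemma monic_factors_mult:
  assumes "monic r p" "monic r q"
  shows "monic_factors (p * q) = monic_factors p + monic_factors q"
  by (rule monic_factors_eqI)
    (use assms monic_factors_Irr[OF assms(1)] monic_factors_Irr[OF assms(2)] in
      \<open>simp_all add: prod_mset_monic_factors\<close>)

lemma monic_factors_tau:
  fixes p :: "('m, 'k::field) mpoly"
  assumes "monic r p"
  shows "monic_factors (tau v p) = image_mset (tau v) (monic_factors p)"
proof (rule monic_factors_eqI)
  show "set_mset (image_mset (tau v) (monic_factors p)) \<subseteq> Irr r"
    using monic_factors_Irr[OF assms] Irr_tau_iff[OF mo] by auto
  have "prod_mset (image_mset (tau v) M) = tau v (prod_mset M)" for M :: "('m, 'k) mpoly multiset"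
    by (induction M) (auto simp: tau_hom)
  then show "prod_mset (image_mset (tau v) (monic_factors p)) = tau v p"
    using prod_mset_monic_factors[OF assms] by simp
qed

lemma count_monic_factors_tau:
  assumes "monic r p"
  shows "count (monic_factors (tau v p)) q = count (monic_factors p) (tau (- v) q)"
proof -
  have "count (image_mset (tau v) M) (tau v f) = count M f" for M f
    by (induction M) (auto simp: tau_eq_iff)
  from this[of "monic_factors p" "tau (- v) q"] show ?thesis by (simp add: monic_factors_tau[OF assms])
qed

lemma monic_eqI:
  assumes "monic r p" "monic r q" "\<And>f. count (monic_factors p) f = count (monic_factors q) f"
  shows "p = q"
  using assms prod_mset_monic_factors multiset_eqI by metis

text \<open>A nonzero value would persist along all iterates of \<open>tau a\<close>. Finite support
  makes two iterates coincide, and \<open>tau_fixed_if_funpow_fixed\<close> then shows that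
  \<open>tau a\<close> fixes \<open>q\<close>. The value type is general to cover both
  multiplicities and their integer differences.\<close>

lemma periodic_finite_support_0:
  fixes g :: "('m, 'k::field_char_0) mpoly \<Rightarrow> 'c::zero"
  assumes fin: "finite {f. g f \<noteq> 0}" and per: "\<And>t. g (tau (t + a) q) = g (tau t q)" and "tau a q \<noteq> q"
  shows "g (tau t q) = 0"
proof (rule ccontr)
  assume g0: "g (tau t q) \<noteq> 0"
  define F where "F n = (tau a ^^ n) (tau t q)" for n
  \<comment> \<open>Periodicity is known only at translates of \<open>q\<close>, so this form is
    carried through the induction.\<close>
  have F: "\<exists>t'. F n = tau t' q \<and> g (F n) \<noteq> 0" for n
  proof (induction n)
    case 0
    then show ?case using g0 by (auto simp: F_def)
  next
    case (Suc n)
    then obtain t' where t': "F n = tau t' q" "g (F n) \<noteq> 0" by blast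
    then have "F (Suc n) = tau (t' + a) q" by (simp add: F_def add.commute)
    then show ?case using per t' by auto
  qed
  then have "range F \<subseteq> {f. g f \<noteq> 0}" by auto
  then have "finite (range F)" using fin finite_subset by blast
  then have "\<not> inj F" using finite_imageD by blast
  then obtain m n where "F m = F n" "m < n"
    unfolding inj_def by (metis linorder_neqE_nat)
  moreover have "F (d + m) = (tau a ^^ d) (F m)" for d by (simp add: F_def funpow_add)
  ultimately have "(tau a ^^ (n - m)) (F m) = F m" by (metis less_imp_le le_add_diff_inverse2)
  then have "tau a (F m) = F m"
    using tau_fixed_if_funpow_fixed[OF mo, where v = a and n = "n - m" and p = "F m"] \<open>m < n\<close> by simp
  moreover obtain t' where "F m = tau t' q" using F by blast
  ultimately have "tau t' (tau a q) = tau t' q" by (simp add: add.commute)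
  then show False using tau_eq_iff assms(3) by metis
qed

lemma tau_half_fixed: "tau (v + v) q = q \<Longrightarrow> tau v q = (q :: ('m, 'k::field_char_0) mpoly)"
  by (rule tau_fixed_if_funpow_fixed[OF mo, where n = 2]) (simp_all add: numeral_2_eq_2)

section \<open>The consistency equations as equations between multiplicities\<close>

context
  fixes A :: "'k::field_char_0 ^ 'n ^ 'm" and p :: "'n \<Rightarrow> ('m, 'k) mpoly"
  assumes monic: "\<And>k. monic r (p k)"
begin

abbreviation "mult_in k f \<equiv> count (monic_factors (p k)) f"

lemma finite_mult_in: "finite {f. mult_in k f \<noteq> 0}"
  by simp

context
  assumes cons: "consistent A p"
begin

text \<open>Counting the factor \<open>q\<close> on both sides turns products into sums, and a
  translation of the polynomial into the opposite translation of \<open>q\<close>.\<close>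

lemma mult_in_consistent:
  assumes "i \<noteq> j"
  shows "mult_in i (tau (half_col A j) q) + mult_in j (tau (half_col A i) q) =
    mult_in i (tau (- half_col A j) q) + mult_in j (tau (- half_col A i) q)"
proof -
  have "count (monic_factors (tau (- half_col A j) (p i) * tau (- half_col A i) (p j))) q =
      count (monic_factors (tau (half_col A j) (p i) * tau (half_col A i) (p j))) q"
    using cons assms by (simp add: consistent_def)
  then show ?thesis
    by (simp add: monic_factors_mult monic_tau[OF mo] monic count_monic_factors_tau)
qed

lemma mult_in_second_difference:
  assumes "i \<noteq> j" "j \<noteq> k" "k \<noteq> i"
  shows "mult_in k (tau (half_col A i + half_col A j) q) + mult_in k (tau (- half_col A i - half_col A j) q) =
    mult_in k (tau (half_col A i - half_col A j) q) + mult_in k (tau (- half_col A i + half_col A j) q)"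
proof -
  define a b c where "a = half_col A i" and "b = half_col A j" and "c = half_col A k"
  note E = mult_in_consistent
  \<comment> \<open>Each pair of indices is used at two points, displaced by the half shift of the
    third index in either direction. Subtracting the two equations of a pair makes two mixed second
    differences opposite; the three relations together make that of \<open>mult_in k\<close> its own
    negative.\<close>
  have 1: "mult_in k (tau (a + b) q) + mult_in i (tau (b + c) q) = mult_in k (tau (- a + b) q) + mult_in i (tau (b - c) q)"
    using E[OF assms(3), of "tau b q"] unfolding a_def b_def c_def by (simp add: algebra_simps)
  have 2: "mult_in k (tau (a - b) q) + mult_in i (tau (- b + c) q) = mult_in k (tau (- a - b) q) + mult_in i (tau (- b - c) q)"
    using E[OF assms(3), of "tau (- b) q"] unfolding a_def b_def c_def by (simp add: algebra_simps)
  have 3: "mult_in i (tau (b + c) q) + mult_in j (tau (a + c) q) = mult_in i (tau (- b + c) q) + mult_in j (tau (- a + c) q)"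
    using E[OF assms(1), of "tau c q"] unfolding a_def b_def c_def by (simp add: algebra_simps)
  have 4: "mult_in i (tau (b - c) q) + mult_in j (tau (a - c) q) = mult_in i (tau (- b - c) q) + mult_in j (tau (- a - c) q)"
    using E[OF assms(1), of "tau (- c) q"] unfolding a_def b_def c_def by (simp add: algebra_simps)
  have 5: "mult_in j (tau (a + c) q) + mult_in k (tau (a + b) q) = mult_in j (tau (a - c) q) + mult_in k (tau (a - b) q)"
    using E[OF assms(2), of "tau a q"] unfolding a_def b_def c_def by (simp add: algebra_simps)
  have 6: "mult_in j (tau (- a + c) q) + mult_in k (tau (- a + b) q) = mult_in j (tau (- a - c) q) + mult_in k (tau (- a - b) q)"
    using E[OF assms(2), of "tau (- a) q"] unfolding a_def b_def c_def by (simp add: algebra_simps)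
  show ?thesis
    using 1 2 3 4 5 6 unfolding a_def[symmetric] b_def[symmetric] by linarith
qed

text \<open>Since the shift by \<open>i\<close> fixes the orbit, \<open>mult_in j\<close> drops out
  of the equation for \<open>i\<close> and \<open>j\<close>. The rest says that
  \<open>mult_in i\<close> is periodic under the shift by \<open>j\<close>, which moves
  \<open>q\<close>.\<close>

lemma mult_in_0_if_one_moves:
  assumes "tau (half_col A i + half_col A i) q = q" "tau (half_col A j + half_col A j) q \<noteq> q"
  shows "mult_in i (tau t q) = 0"
proof (rule periodic_finite_support_0[OF finite_mult_in _ assms(2)])
  fix t
  have ij: "i \<noteq> j" using assms by auto
  have fix_i: "tau (half_col A i) q = q" using tau_half_fixed[OF assms(1)] .
  have shift: "tau (half_col A i + w) q = tau w q" for w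
  proof -
    have "tau (half_col A i + w) q = tau w (tau (half_col A i) q)" by (simp add: add.commute)
    then show ?thesis by (simp only: fix_i)
  qed
  have "mult_in j (tau (half_col A i) (tau w q)) = mult_in j (tau (- half_col A i) (tau w q))" for w
  proof -
    have "tau (- half_col A i + w) q = tau w q" using shift[of "- half_col A i + w", symmetric] by simp
    then show ?thesis using shift[of w] by simp
  qed
  then have "mult_in i (tau (half_col A j) (tau w q)) = mult_in i (tau (- half_col A j) (tau w q))" for w
    using mult_in_consistent[OF ij, of "tau w q"] by simp
  \<comment> \<open>Recentring by a half shift turns the vanishing central difference into a
    period.\<close>
  from this[of "t + half_col A j"]
  show "mult_in i (tau (t + (half_col A j + half_col A j)) q) = mult_in i (tau t q)"
    by (simp add: algebra_simps)
qed

text \<open>Periodicity is used twice: the difference \<open>g\<close> of \<open>mult_in k\<close>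
  along \<open>j\<close> is periodic along \<open>i\<close> by the second difference identity, hence
  0 on the orbit; this in turn makes \<open>mult_in k\<close> periodic along
  \<open>j\<close>.\<close>

lemma mult_in_0_if_two_others_move:
  assumes "i \<noteq> j" "j \<noteq> k" "k \<noteq> i"
    and "tau (half_col A i + half_col A i) q \<noteq> q" "tau (half_col A j + half_col A j) q \<noteq> q"
  shows "mult_in k (tau t q) = 0"
proof (rule periodic_finite_support_0[OF finite_mult_in _ assms(5)])
  fix t
  define a b where "a = half_col A i" and "b = half_col A j"
  define g where "g f = int (mult_in k (tau b f)) - int (mult_in k (tau (- b) f))" for f
  \<comment> \<open>Finiteness: the support of \<open>g\<close> lies in two translates of the
    support of \<open>mult_in k\<close>.\<close>
  have "{f. g f \<noteq> 0} \<subseteq> tau (- b) ` {f. mult_in k f \<noteq> 0} \<union> tau b ` {f. mult_in k f \<noteq> 0}"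
  proof
    fix f assume "f \<in> {f. g f \<noteq> 0}"
    then have "mult_in k (tau b f) \<noteq> 0 \<or> mult_in k (tau (- b) f) \<noteq> 0"
      unfolding g_def mem_Collect_eq by arith
    moreover have "f = tau (- b) (tau b f)" "f = tau b (tau (- b) f)" by simp_all
    ultimately show "f \<in> tau (- b) ` {f. mult_in k f \<noteq> 0} \<union> tau b ` {f. mult_in k f \<noteq> 0}" by blast
  qed
  then have "finite {f. g f \<noteq> 0}" by (rule finite_subset) (simp add: finite_mult_in)
  moreover have "g (tau (w + (a + a)) q) = g (tau w q)" for w
    using mult_in_second_difference[OF assms(1-3), of "tau (w + a) q"]
    unfolding a_def[symmetric] b_def[symmetric] by (simp add: g_def algebra_simps)
  ultimately have "g (tau w q) = 0" for w
    using periodic_finite_support_0[where g = g and a = "a + a" and q = q and t = w] assms(4)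
    unfolding a_def[symmetric] by blast
  from this[of "t + b"] show "mult_in k (tau (t + (half_col A j + half_col A j)) q) = mult_in k (tau t q)"
    unfolding b_def[symmetric] by (simp add: g_def algebra_simps)
qed

lemma second_difference_relation:
  assumes "i \<noteq> j" "j \<noteq> k" "k \<noteq> i"
  shows "tau (- half_col A i - half_col A j) (p k) * tau (half_col A i + half_col A j) (p k) =
    tau (- half_col A i + half_col A j) (p k) * tau (half_col A i - half_col A j) (p k)"
proof (rule monic_eqI)
  fix q
  show "count (monic_factors (tau (- half_col A i - half_col A j) (p k) * tau (half_col A i + half_col A j) (p k))) q =
    count (monic_factors (tau (- half_col A i + half_col A j) (p k) * tau (half_col A i - half_col A j) (p k))) q"
    using mult_in_second_difference[OF assms, of q]
    by (simp add: monic_factors_mult monic_tau[OF mo] monic count_monic_factors_tau algebra_simps)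
qed (simp_all add: monic_mult[OF mo] monic_tau[OF mo] monic)

end

end

end

section \<open>From configurations to solutions\<close>

lemma act_axis:
  fixes A :: "'k::field_char_0 ^ 'n ^ 'm"
  shows "act A (axis k 1) = tau (- (half_col A k + half_col A k))"
  by (simp add: act_eq_tau shift_vec_axis)

lemma orbits_shift_closed:
  fixes A :: "'k::field_char_0 ^ 'n ^ 'm"
  assumes "Q \<in> orbits r A" "q \<in> Q"
  shows "tau (half_col A k + half_col A k) q \<in> Q" "tau (- (half_col A k + half_col A k)) q \<in> Q"
proof -
  obtain q0 x where q: "Q = range (\<lambda>x. act A x q0)" "q = act A x q0"
    using assms by (auto simp: orbits_def)
  have "tau (half_col A k + half_col A k) q = act A (x - axis k 1) q0"
    by (simp only: q(2) act_eq_tau tau_tau diff_conv_add_uminus shift_vec_add shift_vec_uminus shift_vec_axis)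
      (simp add: algebra_simps)
  moreover have "tau (- (half_col A k + half_col A k)) q = act A (x + axis k 1) q0"
    by (simp only: q(2) act_eq_tau tau_tau shift_vec_add shift_vec_axis) (simp add: algebra_simps)
  ultimately show "tau (half_col A k + half_col A k) q \<in> Q" "tau (- (half_col A k + half_col A k)) q \<in> Q"
    using q(1) by auto
qed

lemma consistent_prod:
  assumes "\<And>a. a \<in> S \<Longrightarrow> consistent A (P a)"
  shows "consistent A (\<lambda>k. \<Prod>a\<in>S. P a k)"
  unfolding consistent_def
proof (intro allI impI)
  fix i j :: 'c assume "i \<noteq> j"
  then show "tau (- half_col A j) (\<Prod>a\<in>S. P a i) * tau (- half_col A i) (\<Prod>a\<in>S. P a j) =
      tau (half_col A j) (\<Prod>a\<in>S. P a i) * tau (half_col A i) (\<Prod>a\<in>S. P a j)"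
    using assms unfolding tau_hom(8) prod.distrib[symmetric]
    by (intro prod.cong refl) (auto simp: consistent_def)
qed

text \<open>Brings products over different edge sets to one common set \<open>T\<close> of vertices;
  the added vertices have exponent 0.\<close>

lemma tau_prod_powers:
  fixes L :: "('m::finite, 'k::comm_ring_1) mpoly \<Rightarrow> nat"
  assumes "finite T" "tau w ` {f \<in> E. L f \<noteq> 0} \<subseteq> T" "\<And>v. v \<in> T \<Longrightarrow> tau (- w) v \<in> E"
  shows "tau w (\<Prod>f\<in>{f \<in> E. L f \<noteq> 0}. f ^ L f) = (\<Prod>v\<in>T. v ^ L (tau (- w) v))"
proof -
  let ?S = "{f \<in> E. L f \<noteq> 0}"
  have "tau w (\<Prod>f\<in>?S. f ^ L f) = (\<Prod>f\<in>?S. tau w f ^ L (tau (- w) (tau w f)))"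
    by (simp add: tau_hom)
  also have "\<dots> = (\<Prod>v\<in>tau w ` ?S. v ^ L (tau (- w) v))"
    by (subst prod.reindex[OF inj_tau]) simp
  also have "\<dots> = (\<Prod>v\<in>T. v ^ L (tau (- w) v))"
  proof (rule prod.mono_neutral_left[OF assms(1,2)], rule ballI)
    fix v assume v: "v \<in> T - tau w ` ?S"
    have "v = tau w (tau (- w) v)" by simp
    then have "tau (- w) v \<notin> ?S" using v by blast
    then have "L (tau (- w) v) = 0" using assms(3) v by blast
    then show "v ^ L (tau (- w) v) = 1" by simp
  qed
  finally show ?thesis .
qed

lemma edges_iff: "f \<in> edges A Q k \<longleftrightarrow> tau (half_col A k) f \<in> Q"
proof
  assume "tau (half_col A k) f \<in> Q"
  moreover have "f = tau (- half_col A k) (tau (half_col A k) f)" by simp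
  ultimately show "f \<in> edges A Q k" unfolding edges_def sigma_half_eq_tau by blast
qed (auto simp: edges_def sigma_half_eq_tau)

text \<open>All four translated products become products over the same vertices, with the labels of
  the four edges at each vertex as exponents. The vertex condition then matches the two sides vertex
  by vertex.\<close>

lemma config_factor_pair:
  fixes A :: "'k::field_char_0 ^ 'n ^ 'm::finite"
  assumes Q: "Q \<in> orbits r A" and vc: "vertex_config A Q i j L" and fc: "finite_config A Q i j L"
  shows "tau (- half_col A j) (config_factor A Q i j L i) * tau (- half_col A i) (config_factor A Q i j L j) =
    tau (half_col A j) (config_factor A Q i j L i) * tau (half_col A i) (config_factor A Q i j L j)"
proof -
  define a b where "a = half_col A i" and "b = half_col A j"
  define V where "V = vertices A Q i j"
  have closed: "tau (a + a) q \<in> Q" "tau (b + b) q \<in> Q" if "q \<in> Q" for q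
    using orbits_shift_closed(1)[OF Q that] by (auto simp: a_def b_def)
  have V: "v \<in> V \<longleftrightarrow> tau (a + b) v \<in> Q" for v
  proof
    assume "v \<in> V"
    then obtain q where "q \<in> Q" "v = tau (- a + - b) q"
      by (auto simp: V_def vertices_def sigma_half_eq_tau a_def b_def)
    then show "tau (a + b) v \<in> Q" by simp
  next
    assume "tau (a + b) v \<in> Q"
    moreover have "v = sigma_half A i (sigma_half A j (tau (a + b) v))"
      by (simp add: sigma_half_eq_tau a_def b_def)
    ultimately show "v \<in> V" unfolding V_def vertices_def by blast
  qed
  have E: "f \<in> edges A Q i \<longleftrightarrow> tau a f \<in> Q" "f \<in> edges A Q j \<longleftrightarrow> tau b f \<in> Q" for f
    by (simp_all add: edges_iff a_def b_def)
  let ?Si = "{f \<in> edges A Q i. L i f \<noteq> 0}" and ?Sj = "{f \<in> edges A Q j. L j f \<noteq> 0}"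
  \<comment> \<open>All endpoints of edges with nonzero label: a finite set, while the set of
    vertices may be infinite.\<close>
  define T where "T = tau b ` ?Si \<union> tau (- b) ` ?Si \<union> tau a ` ?Sj \<union> tau (- a) ` ?Sj"
  have T: "finite T" using fc by (auto simp: T_def finite_config_def)
  have T_V: "T \<subseteq> V"
  proof
    fix v assume "v \<in> T"
    then consider f where "f \<in> ?Si" "v = tau b f" | f where "f \<in> ?Si" "v = tau (- b) f"
      | f where "f \<in> ?Sj" "v = tau a f" | f where "f \<in> ?Sj" "v = tau (- a) f"
      unfolding T_def by blast
    then show "v \<in> V"
    proof cases
      \<comment> \<open>This endpoint lies a full shift beyond the opposite one, so closure of the
        orbit under full shifts is used.\<close>
      case 1
      then show ?thesis using closed(2)[of "tau a f"] by (simp add: V E algebra_simps)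
    next
      case 2
      then show ?thesis by (simp add: V E)
    next
      case 3
      then show ?thesis using closed(1)[of "tau b f"] by (simp add: V E algebra_simps)
    next
      case 4
      then show ?thesis by (simp add: V E)
    qed
  qed
  have TE: "tau (- b) v \<in> edges A Q i" "tau b v \<in> edges A Q i" "tau (- a) v \<in> edges A Q j" "tau a v \<in> edges A Q j"
    if "v \<in> T" for v
  proof -
    have v: "tau (a + b) v \<in> Q" using that T_V V by blast
    have "tau (- (b + b)) (tau (a + b) v) \<in> Q" "tau (- (a + a)) (tau (a + b) v) \<in> Q"
      unfolding a_def b_def by (rule orbits_shift_closed(2)[OF Q v[unfolded a_def b_def]])+
    then show "tau (- b) v \<in> edges A Q i" "tau b v \<in> edges A Q i" "tau (- a) v \<in> edges A Q j" "tau a v \<in> edges A Q j"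
      using v by (simp_all add: E algebra_simps)
  qed
  have Fi: "config_factor A Q i j L i = (\<Prod>f\<in>?Si. f ^ L i f)" "config_factor A Q i j L j = (\<Prod>f\<in>?Sj. f ^ L j f)"
    by (simp_all add: config_factor_def)
  have "tau (- b) (\<Prod>f\<in>?Si. f ^ L i f) = (\<Prod>v\<in>T. v ^ L i (tau b v))"
    using tau_prod_powers[OF T, of "- b" "edges A Q i" "L i"] TE by (auto simp: T_def)
  moreover have "tau b (\<Prod>f\<in>?Si. f ^ L i f) = (\<Prod>v\<in>T. v ^ L i (tau (- b) v))"
    using tau_prod_powers[OF T, of b "edges A Q i" "L i"] TE by (auto simp: T_def)
  moreover have "tau (- a) (\<Prod>f\<in>?Sj. f ^ L j f) = (\<Prod>v\<in>T. v ^ L j (tau a v))"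
    using tau_prod_powers[OF T, of "- a" "edges A Q j" "L j"] TE by (auto simp: T_def)
  moreover have "tau a (\<Prod>f\<in>?Sj. f ^ L j f) = (\<Prod>v\<in>T. v ^ L j (tau (- a) v))"
    using tau_prod_powers[OF T, of a "edges A Q j" "L j"] TE by (auto simp: T_def)
  moreover have "L i (tau b v) + L j (tau a v) = L i (tau (- b) v) + L j (tau (- a) v)" if "v \<in> T" for v
    using vc that T_V unfolding vertex_config_def V_def sigma_half_eq_tau sigma_neg_half_eq_tau a_def b_def by auto
  ultimately show ?thesis
    unfolding Fi a_def[symmetric] b_def[symmetric]
    by (simp add: prod.distrib[symmetric] power_add[symmetric])
qed

text \<open>The two half shifts by \<open>y\<close> differ by a full shift, which fixes every edge
  over \<open>Q\<close>.\<close>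

lemma config_factor_fixed:
  fixes A :: "'k::field_char_0 ^ 'n ^ 'm::finite"
  assumes "\<And>q. q \<in> Q \<Longrightarrow> act A (axis y 1) q = q"
  shows "tau (- half_col A y) (config_factor A Q i j L x) = tau (half_col A y) (config_factor A Q i j L x)"
proof -
  have "tau (- half_col A y) f = tau (half_col A y) f" if f: "f \<in> edges A Q x" for f
  proof -
    obtain q where q: "q \<in> Q" "f = tau (- half_col A x) q"
      using f by (auto simp: edges_def sigma_half_eq_tau)
    have "tau (half_col A y) f = tau (half_col A y - half_col A x) (tau (- (half_col A y + half_col A y)) q)"
      using q assms[OF q(1)] by (simp add: act_axis)
    also have "\<dots> = tau (- half_col A y) f" using q(2) by simp
    finally show ?thesis ..
  qed
  then show ?thesis by (auto simp: config_factor_def tau_hom intro!: prod.cong)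
qed

text \<open>An index outside \<open>{i, j}\<close> has factor 1 and its half shifts agree on the
  other factor; the remaining equation is \<open>config_factor_pair\<close>.\<close>

lemma consistent_config_factor:
  fixes A :: "'k::field_char_0 ^ 'n ^ 'm::finite"
  assumes Q: "Q \<in> orbits r A" and vc: "vertex_config A Q i j L" and fc: "finite_config A Q i j L"
    and fixed: "\<And>k q. k \<notin> {i, j} \<Longrightarrow> q \<in> Q \<Longrightarrow> act A (axis k 1) q = q"
  shows "consistent A (config_factor A Q i j L)"
  unfolding consistent_def
proof (intro allI impI)
  fix x y :: 'n assume "x \<noteq> y"
  have one: "config_factor A Q i j L k = 1" if "k \<notin> {i, j}" for k
    using that by (auto simp: config_factor_def)
  consider "y \<notin> {i, j}" | "x \<notin> {i, j}" | "x = i" "y = j" | "x = j" "y = i" using \<open>x \<noteq> y\<close> by blast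
  then show "tau (- half_col A y) (config_factor A Q i j L x) * tau (- half_col A x) (config_factor A Q i j L y) =
      tau (half_col A y) (config_factor A Q i j L x) * tau (half_col A x) (config_factor A Q i j L y)"
  proof cases
    case 1
    then show ?thesis using config_factor_fixed[of Q A y] fixed one by (simp add: tau_hom)
  next
    case 2
    then show ?thesis using config_factor_fixed[of Q A x] fixed one by (simp add: tau_hom)
  next
    case 3
    then show ?thesis using config_factor_pair[OF Q vc fc] by simp
  next
    case 4
    then show ?thesis using config_factor_pair[OF Q vc fc] by (simp add: mult.commute)
  qed
qed

section \<open>From solutions to configurations\<close>

definition orbit_of ::
    "'k::comm_ring_1 ^ 'n ^ 'm \<Rightarrow> ('m::finite, 'k) mpoly \<Rightarrow> ('m, 'k) mpoly set" where
  "orbit_of A q = range (\<lambda>x. act A x q)"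

lemma orbit_of_self: "q \<in> orbit_of A q"
proof -
  have "act A 0 q = q" by (simp add: act_eq_tau shift_vec_0)
  then show ?thesis unfolding orbit_of_def by (metis rangeI)
qed

lemma orbit_of_eq:
  assumes "f \<in> orbit_of A q"
  shows "orbit_of A f = orbit_of A q"
proof -
  obtain x where f: "f = act A x q" using assms by (auto simp: orbit_of_def)
  have 1: "act A y f = act A (y + x) q" for y
    by (simp add: f act_eq_tau shift_vec_add algebra_simps)
  have 2: "act A y q = act A (y - x) f" for y
    using 1[of "y - x"] by simp
  show ?thesis
  proof
    show "orbit_of A f \<subseteq> orbit_of A q" unfolding orbit_of_def using 1 by auto
    show "orbit_of A q \<subseteq> orbit_of A f" unfolding orbit_of_def using 2 by blast
  qed
qed

lemma orbit_ofE:
  assumes "f \<in> orbit_of A q"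
  obtains t where "f = tau t q"
  using assms by (auto simp: orbit_of_def act_eq_tau)

lemma edges_orbit_ofE:
  assumes "f \<in> edges A (orbit_of A q) k"
  obtains t where "f = tau t q"
  using assms by (auto simp: edges_def sigma_half_eq_tau elim!: orbit_ofE)

lemma tau_fixed_tau:
  assumes "tau v q = q"
  shows "tau v (tau t q) = tau t q"
proof -
  have "tau v (tau t q) = tau t (tau v q)" by (simp add: add.commute)
  then show ?thesis by (simp only: assms)
qed

text \<open>The vectors whose translation fixes \<open>q\<close> form a group \<open>G\<close>;
  containing the shift vectors of the basis, it contains those of all lattice points.\<close>

lemma orbit_of_fixed:
  fixes A :: "'k::field_char_0 ^ 'n ^ 'm::finite"
  assumes "\<And>k. tau (half_col A k + half_col A k) q = q"
  shows "orbit_of A q = {q}"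
proof -
  define G where "G = {v. tau v q = q}"
  have G_add: "v + w \<in> G" if "v \<in> G" "w \<in> G" for v w
    using that tau_tau[where v = v and w = w and p = q] by (simp add: G_def del: tau_tau)
  have G_uminus: "- v \<in> G" if "v \<in> G" for v
    using that tau_tau[where v = "- v" and w = v and p = q] by (simp add: G_def del: tau_tau)
  have axis: "shift_vec A (axis k 1) \<in> G" for k
    using assms by (simp add: G_def shift_vec_axis)
  have single: "shift_vec A (axis k n) \<in> G" for k and n :: int
  proof (induction n rule: int_induct[of _ 0])
    case base
    have "axis k (0::int) = 0" by (simp add: axis_def vec_eq_iff)
    then show ?case by (simp only: shift_vec_0 G_def mem_Collect_eq tau_0)
  next
    case (step1 n)
    have "axis k (n + 1) = axis k n + axis k 1" by (simp add: axis_def vec_eq_iff)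
    then show ?case using G_add[OF step1(2) axis] by (simp add: shift_vec_add)
  next
    case (step2 n)
    have "axis k (n - 1) = axis k n + - axis k 1" by (simp add: axis_def vec_eq_iff)
    then show ?case using G_add[OF step2(2) G_uminus[OF axis]] by (simp only: shift_vec_add shift_vec_uminus)
  qed
  have sum: "shift_vec A (\<Sum>k\<in>K. axis k (x $ k)) \<in> G" if "finite K" for K x
    using that by induction (simp_all add: shift_vec_0 shift_vec_add single G_add, simp add: G_def)
  have "(\<Sum>k\<in>UNIV. axis k (x $ k)) = x" for x :: "int ^ 'n"
    by (simp add: vec_eq_iff axis_def if_distrib cong: if_cong)
  then have "shift_vec A x \<in> G" for x using sum[OF finite[of UNIV], of x] by simp
  then have "act A x q = q" for x using G_uminus[of "shift_vec A x"] by (simp add: act_eq_tau G_def)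
  then show ?thesis by (simp add: orbit_of_def)
qed

text \<open>
  Several entries \<open>{i, j}\<close>, \<open>j \<in> J\<close>, are needed only for a fixed polynomial; its multiplicity in \<open>p i\<close> is then
  carried by the entry \<open>{i, j0}\<close> alone.
\<close>
definition split_config ::
    "('n \<Rightarrow> 'b \<Rightarrow> nat) \<Rightarrow> 'n \<Rightarrow> 'n \<Rightarrow> 'n \<Rightarrow> 'b \<Rightarrow> nat" where
  "split_config M j0 j k f = (if k = j \<or> j = j0 then M k f else 0)"

lemma split_config_self: "split_config M j j = M"
  by (intro ext) (simp add: split_config_def)

text \<open>Exactly one entry \<open>s\<close> carries the factors of index \<open>k\<close>:
  \<open>k\<close> itself if \<open>k\<close> is in \<open>J\<close>, and \<open>j0\<close> if
  \<open>k = i\<close>. The other entries contribute 1.\<close>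

lemma prod_split_config:
  fixes A :: "'k::field ^ 'n ^ 'm::finite"
  assumes "i \<notin> J" "j0 \<in> J"
    and zero: "\<And>f. k \<notin> insert i J \<Longrightarrow> f \<in> edges A Q k \<Longrightarrow> M k f = 0"
  shows "(\<Prod>j\<in>J. config_factor A Q i j (split_config M j0 j) k) = (\<Prod>f\<in>{f \<in> edges A Q k. M k f \<noteq> 0}. f ^ M k f)"
proof -
  let ?P = "\<Prod>f\<in>{f \<in> edges A Q k. M k f \<noteq> 0}. f ^ M k f"
  define s where "s = (if k = i then j0 else k)"
  have "config_factor A Q i j (split_config M j0 j) k = (if j = s then ?P else 1)" if "j \<in> J" for j
    using that assms(1) by (auto simp: config_factor_def split_config_def s_def)
  then have "(\<Prod>j\<in>J. config_factor A Q i j (split_config M j0 j) k) = (\<Prod>j\<in>J. if j = s then ?P else 1)"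
    by (intro prod.cong refl)
  also have "\<dots> = (if s \<in> J then ?P else 1)" by simp
  also have "\<dots> = ?P"
  proof (cases "s \<in> J")
    case False
    then have "k \<notin> insert i J" using assms(2) by (auto simp: s_def split: if_splits)
    then have none: "{f \<in> edges A Q k. M k f \<noteq> 0} = {}" using zero by auto
    show ?thesis using False unfolding none by simp
  qed simp
  finally show ?thesis .
qed

section \<open>Index pairs and configurations for each orbit\<close>

context
  fixes r :: "('m::finite \<Rightarrow>\<^sub>0 nat) rel" and A :: "'k::field_char_0 ^ 'n ^ 'm"
    and p :: "'n \<Rightarrow> ('m, 'k) mpoly"
  assumes mo: "monomial_order r" and card_n: "CARD('n) \<ge> 2"
    and monic: "\<And>k. monic r (p k)" and cons: "consistent A p"
begin

abbreviation mul :: "'n \<Rightarrow> ('m, 'k) mpoly \<Rightarrow> nat" where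
  "mul k f \<equiv> count (monic_factors r (p k)) f"

lemma other_index: "\<exists>j. j \<noteq> (i::'n)"
proof (rule ccontr)
  assume "\<nexists>j. j \<noteq> i"
  then have "UNIV = {i}" by auto
  then have "CARD('n) = 1" by (metis card_1_singleton_iff One_nat_def)
  then show False using card_n by simp
qed

text \<open>The index pairs of one orbit form a star with centre \<open>i\<close>, one pair
  \<open>{i, j}\<close> for each \<open>j\<close> in \<open>J\<close>; \<open>j0\<close> marks the
  pair that carries the multiplicities of \<open>i\<close>. An orbit with more than one element has
  a single pair.\<close>

definition good_entries :: "('m, 'k) mpoly set \<Rightarrow> 'n \<Rightarrow> 'n set \<Rightarrow> 'n \<Rightarrow> bool" where
  "good_entries Q i J j0 \<longleftrightarrow> i \<notin> J \<and> j0 \<in> J \<and>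
     (\<forall>j\<in>J. \<forall>k. k \<notin> {i, j} \<longrightarrow> (\<forall>q\<in>Q. act A (axis k 1) q = q)) \<and>
     (\<forall>k f. k \<notin> insert i J \<and> f \<in> edges A Q k \<longrightarrow> mul k f = 0) \<and>
     (\<forall>j\<in>J. vertex_config A Q i j (split_config mul j0 j)) \<and>
     (card J \<ge> 2 \<longrightarrow> (\<exists>q. Q = {q} \<and> card {k. q dvd p k} \<ge> 3))"

lemma good_entriesD:
  assumes "good_entries Q i J j0"
  shows "i \<notin> J" "j0 \<in> J"
    and "j \<in> J \<Longrightarrow> k \<notin> {i, j} \<Longrightarrow> q \<in> Q \<Longrightarrow> act A (axis k 1) q = q"
    and "k \<notin> insert i J \<Longrightarrow> f \<in> edges A Q k \<Longrightarrow> mul k f = 0"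
    and "j \<in> J \<Longrightarrow> vertex_config A Q i j (split_config mul j0 j)"
    and "card J \<ge> 2 \<Longrightarrow> \<exists>q. Q = {q} \<and> card {k. q dvd p k} \<ge> 3"
  using assms unfolding good_entries_def by blast+

text \<open>The index \<open>i\<close> must move \<open>q\<close>, and at most one further index
  can, for otherwise the multiplicity of \<open>i\<close> would vanish. As \<open>i\<close> moves
  \<open>q\<close>, the fixed indices have multiplicity 0, so one pair covers the orbit.\<close>

lemma good_entries_moving:
  assumes "mul i (tau (- half_col A i) q) \<noteq> 0" "tau (half_col A k0 + half_col A k0) q \<noteq> q"
  shows "\<exists>J j0. good_entries (orbit_of A q) i J j0"
proof -
  let ?d = "\<lambda>k. half_col A k + half_col A k"
  note one = mult_in_0_if_one_moves[OF mo monic cons] and two = mult_in_0_if_two_others_move[OF mo monic cons]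
  have i: "tau (?d i) q \<noteq> q" using one[where i = i and j = k0 and q = q and t = "- half_col A i"] assms by argo
  obtain j where j: "j \<noteq> i" "\<And>k. k \<notin> {i, j} \<Longrightarrow> tau (?d k) q = q"
  proof (cases "\<exists>j. j \<noteq> i \<and> tau (?d j) q \<noteq> q")
    case True
    then obtain j where j: "j \<noteq> i" "tau (?d j) q \<noteq> q" by blast
    have "tau (?d k) q = q" if "k \<notin> {i, j}" for k
      using two[where i = j and j = k and k = i and q = q and t = "- half_col A i"] j that assms(1) by auto
    then show ?thesis using that j by blast
  next
    \<comment> \<open>No other index moves \<open>q\<close>, so any partner will do; one exists
      because there are at least two indices.\<close>
    case False
    then show ?thesis using other_index[of i] that by blast
  qed
  have "good_entries (orbit_of A q) i {j} j"
    unfolding good_entries_def split_config_self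
  proof (intro conjI ballI allI impI)
    fix j' k q' assume *: "j' \<in> {j}" "k \<notin> {i, j'}" "q' \<in> orbit_of A q"
    then obtain t where "q' = tau t q" by (auto elim: orbit_ofE)
    moreover have "tau (- (?d k)) q = q" using j(2)[of k] * by (metis empty_iff insert_iff tau_tau left_minus tau_0)
    ultimately show "act A (axis k 1) q' = q'" using tau_fixed_tau by (simp only: act_axis)
  next
    fix k f assume *: "k \<notin> {i, j} \<and> f \<in> edges A (orbit_of A q) k"
    then obtain t where "f = tau t q" by (auto elim: edges_orbit_ofE)
    then show "mul k f = 0" using one[OF j(2) i, of k] * by auto
  next
    fix j' assume "j' \<in> {j}"
    then show "vertex_config A (orbit_of A q) i j' (split_config mul j j')"
      using j(1) mult_in_consistent[OF mo monic cons, of i j]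
      by (simp add: vertex_config_def split_config_self sigma_half_eq_tau sigma_neg_half_eq_tau)
  qed (use j in auto)
  then show ?thesis by blast
qed

text \<open>The orbit is \<open>{q}\<close> and every edge is \<open>q\<close>, so the vertex
  condition holds for all labels. It remains to reach each index where \<open>q\<close> occurs by a
  pair through \<open>i\<close>.\<close>

lemma good_entries_fixed:
  assumes q: "q \<in> Irr r" "mul i (tau (- half_col A i) q) \<noteq> 0"
    and fixed: "\<And>k. tau (half_col A k + half_col A k) q = q"
  shows "\<exists>J j0. good_entries (orbit_of A q) i J j0"
proof -
  have half: "tau (half_col A k) q = q" for k
    using tau_half_fixed[OF mo fixed] .
  have nhalf: "tau (- half_col A k) q = q" for k
    using half[of k] by (metis tau_tau left_minus tau_0)
  have O: "orbit_of A q = {q}" by (rule orbit_of_fixed[OF fixed])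
  have edge: "edges A {q} k = {q}" for k by (simp add: edges_def sigma_half_eq_tau nhalf)
  define K where "K = {k. mul k q \<noteq> 0}"
  have iK: "i \<in> K" using q(2) nhalf[of i] by (simp add: K_def)
  obtain j' where j': "j' \<noteq> i" using other_index by blast
  \<comment> \<open>If \<open>q\<close> occurs for \<open>i\<close> only, the partner is arbitrary.
    Otherwise the partners are exactly the other indices where \<open>q\<close> occurs, so two
    partners already mean three occurrences.\<close>
  define J where "J = (if K = {i} then {j'} else K - {i})"
  have J: "i \<notin> J" "K \<subseteq> insert i J" "J \<noteq> {}" using j' iK by (auto simp: J_def)
  then obtain j0 where j0: "j0 \<in> J" by blast
  have "good_entries {q} i J j0"
    unfolding good_entries_def
  proof (intro conjI ballI allI impI)
    fix j k q' assume "q' \<in> {q}"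
    then have "q' = q" by simp
    then show "act A (axis k 1) q' = q'"
      using fixed[of k] unfolding act_axis by (metis tau_tau left_minus tau_0)
  next
    fix k f assume "k \<notin> insert i J \<and> f \<in> edges A {q} k"
    then have "k \<notin> K" "f = q" using J(2) edge by auto
    then show "mul k f = 0" by (simp add: K_def count_eq_zero_iff)
  next
    fix j assume "j \<in> J"
    then have "i \<noteq> j" using J(1) by blast
    then show "vertex_config A {q} i j (split_config mul j0 j)"
      by (simp add: vertex_config_def vertices_def sigma_half_eq_tau sigma_neg_half_eq_tau half nhalf del: tau_tau)
  next
    assume "2 \<le> card J"
    then have "J = K - {i}" by (auto simp: J_def split: if_splits)
    then have "card K \<ge> 3" using \<open>2 \<le> card J\<close> iK by (simp add: card_Diff_singleton)
    moreover have "K \<subseteq> {k. q dvd p k}"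
    proof
      fix k assume "k \<in> K"
      then have "q \<in># monic_factors r (p k)" by (simp add: K_def)
      then show "k \<in> {k. q dvd p k}"
        using dvd_prod_mset[of q "monic_factors r (p k)"] prod_mset_monic_factors[OF mo monic, of k] by simp
    qed
    ultimately have "card {k. q dvd p k} \<ge> 3" using card_mono[of "{k. q dvd p k}" K] by simp
    then show "\<exists>q'. {q} = {q'} \<and> card {k. q' dvd p k} \<ge> 3" by blast
  qed (use J j0 in auto)
  then show ?thesis unfolding O by blast
qed

text \<open>A factor \<open>f\<close> of \<open>p k\<close> is to be an edge over its orbit, so the
  inverse of \<open>sigma_half A k\<close> leads back to that orbit.\<close>

definition occurring_orbits :: "('m, 'k) mpoly set set" where
  "occurring_orbits = (\<Union>k. (\<lambda>f. orbit_of A (tau (half_col A k) f)) ` set_mset (monic_factors r (p k)))"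

lemma finite_occurring_orbits: "finite occurring_orbits"
  by (simp add: occurring_orbits_def)

lemma occurring_orbits_good:
  assumes "Q \<in> occurring_orbits"
  shows "Q \<in> orbits r A" "\<exists>i J j0. good_entries Q i J j0"
proof -
  obtain k f where f: "f \<in># monic_factors r (p k)" "Q = orbit_of A (tau (half_col A k) f)"
    using assms by (auto simp: occurring_orbits_def)
  define q where "q = tau (half_col A k) f"
  have q: "q \<in> Irr r"
    using f(1) monic_factors_Irr[OF mo monic, of k] Irr_tau_iff[OF mo] unfolding q_def by blast
  then show "Q \<in> orbits r A" using f(2) by (auto simp: orbits_def orbit_of_def q_def)
  have mul: "mul k (tau (- half_col A k) q) \<noteq> 0" using f(1) by (simp add: q_def)
  show "\<exists>i J j0. good_entries Q i J j0"
  proof (cases "\<exists>k0. tau (half_col A k0 + half_col A k0) q \<noteq> q")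
    case True
    then show ?thesis using good_entries_moving[OF mul] f(2) q_def by blast
  next
    case False
    then show ?thesis using good_entries_fixed[OF q mul] f(2) q_def by blast
  qed
qed

text \<open>Each irreducible factor of \<open>p k\<close> is an edge over exactly one occurring
  orbit, so this is the factorization of \<open>p k\<close> regrouped.\<close>

lemma prod_occurring_orbits:
  "(\<Prod>Q\<in>occurring_orbits. \<Prod>f\<in>{f \<in> edges A Q k. mul k f \<noteq> 0}. f ^ mul k f) = p k"
proof -
  let ?S = "\<lambda>Q. {f \<in> edges A Q k. mul k f \<noteq> 0}"
  have fin: "finite {f. mul k f \<noteq> 0}" by simp
  then have finS: "finite (?S Q)" for Q by (rule rev_finite_subset) auto
  have disj: "?S Q \<inter> ?S Q' = {}" if Q: "Q \<in> occurring_orbits" "Q' \<in> occurring_orbits" "Q \<noteq> Q'" for Q Q'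
  proof -
    have "\<exists>q. R = orbit_of A q" if "R \<in> occurring_orbits" for R
      using that by (auto simp: occurring_orbits_def)
    then obtain q q' where q: "Q = orbit_of A q" "Q' = orbit_of A q'" using Q(1,2) by blast
    have "Q = Q'" if "f \<in> Q" "f \<in> Q'" for f using that orbit_of_eq q by metis
    then show ?thesis using \<open>Q \<noteq> Q'\<close> by (auto simp: edges_iff)
  qed
  have union: "(\<Union>Q\<in>occurring_orbits. ?S Q) = {f. mul k f \<noteq> 0}"
  proof (intro equalityI subsetI)
    fix f assume "f \<in> {f. mul k f \<noteq> 0}"
    then have "orbit_of A (tau (half_col A k) f) \<in> occurring_orbits" "mul k f \<noteq> 0"
      by (auto simp: occurring_orbits_def)
    moreover have "f \<in> edges A (orbit_of A (tau (half_col A k) f)) k"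
      using orbit_of_self by (simp add: edges_iff)
    ultimately show "f \<in> (\<Union>Q\<in>occurring_orbits. ?S Q)" by blast
  qed auto
  have "(\<Prod>Q\<in>occurring_orbits. \<Prod>f\<in>?S Q. f ^ mul k f) = (\<Prod>f\<in>(\<Union>Q\<in>occurring_orbits. ?S Q). f ^ mul k f)"
    using finS disj by (intro prod.UNION_disjoint[symmetric] finite_occurring_orbits) auto
  also have "\<dots> = (\<Prod>f\<in>set_mset (monic_factors r (p k)). f ^ mul k f)"
    unfolding union by (rule prod.cong) auto
  also have "\<dots> = p k"
    using prod_mset_monic_factors[OF mo monic, of k] by (simp add: prod_mset_multiplicity)
  finally show ?thesis .
qed

lemma orbit_decomposition:
  "\<exists>d Q i j L. orbit_data r A d Q i j L \<and> orbits_distinct p d Q i j \<and>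
     (\<forall>k. p k = (\<Prod>a\<in>{1..d}. config_factor A (Q a) (i a) (j a) (L a) k))"
proof -
  have "\<forall>Q\<in>occurring_orbits. \<exists>i J j0. good_entries Q i J j0"
    using occurring_orbits_good(2) by blast
  then obtain i0 J j0 where good: "\<And>Q. Q \<in> occurring_orbits \<Longrightarrow> good_entries Q (i0 Q) (J Q) (j0 Q)"
    unfolding bchoice_iff by blast
  \<comment> \<open>One entry for each orbit and each of its partners; \<open>e\<close> numbers them
    from 1.\<close>
  define I where "I = (SIGMA Q:occurring_orbits. J Q)"
  have "finite I" unfolding I_def using finite_occurring_orbits by (intro finite_SigmaI) auto
  then obtain e where e: "bij_betw e {1..card I} I" using ex_bij_betw_nat_finite_1 by blast
  define Q i j L where "Q a = fst (e a)" and "i a = i0 (Q a)" and "j a = snd (e a)"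
    and "L a = split_config mul (j0 (Q a)) (j a)" for a
  have mem: "Q a \<in> occurring_orbits" "j a \<in> J (Q a)" if "a \<in> {1..card I}" for a
  proof -
    have "e a \<in> I" using e that by (auto simp: bij_betw_def)
    then show "Q a \<in> occurring_orbits" "j a \<in> J (Q a)" by (auto simp: I_def Q_def j_def)
  qed
  have "orbit_data r A (card I) Q i j L"
    unfolding orbit_data_def
  proof (intro ballI conjI)
    fix a assume a: "a \<in> {1..card I}"
    note g = good_entriesD[OF good[OF mem(1)[OF a]]] and m = mem[OF a]
    show "Q a \<in> orbits r A" by (rule occurring_orbits_good(1)[OF m(1)])
    show "i a \<noteq> j a" using g(1) m(2) unfolding i_def by metis
    show "\<forall>k. k \<notin> {i a, j a} \<longrightarrow> (\<forall>q\<in>Q a. act A (axis k 1) q = q)"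
      unfolding i_def by (intro allI impI ballI g(3)[OF m(2)])
    show "vertex_config A (Q a) (i a) (j a) (L a)" unfolding i_def L_def by (rule g(5)[OF m(2)])
    have "finite {f \<in> edges A (Q a) k. L a k f \<noteq> 0}" for k
      by (rule finite_subset[of _ "set_mset (monic_factors r (p k))"])
        (auto simp: L_def split_config_def split: if_splits)
    then show "finite_config A (Q a) (i a) (j a) (L a)" by (simp add: finite_config_def)
  qed
  moreover have "orbits_distinct p (card I) Q i j"
    unfolding orbits_distinct_def
  proof (intro ballI impI)
    fix a b assume a: "a \<in> {1..card I}" and b: "b \<in> {1..card I}" and ab: "a \<noteq> b \<and> Q a = Q b"
    note g = good_entriesD[OF good[OF mem(1)[OF a]]]
    \<comment> \<open>Entries over the same orbit share the centre and so differ in the partner. Two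
      partners put the orbit in the exceptional case, and as the centre is no partner, the two pairs
      are distinct.\<close>
    have "e a \<noteq> e b" using inj_on_eq_iff[OF bij_betw_imp_inj_on[OF e] a b] ab by blast
    then have jab: "j a \<noteq> j b" using ab unfolding j_def Q_def by (metis prod_eqI)
    have J: "j a \<in> J (Q a)" "j b \<in> J (Q a)" using mem(2)[OF a] mem(2)[OF b] ab by simp_all
    have "card {j a, j b} \<le> card (J (Q a))" by (rule card_mono) (simp_all add: J)
    then have "2 \<le> card (J (Q a))" using jab by simp
    then have "\<exists>q. Q a = {q} \<and> card {k. q dvd p k} \<ge> 3" by (rule g(6))
    moreover have "{i a, j a} \<noteq> {i b, j b}"
      using g(1) J jab ab unfolding i_def doubleton_eq_iff by metis
    ultimately show "{i a, j a} \<noteq> {i b, j b} \<and> (\<exists>q. Q a = {q} \<and> card {k. q dvd p k} \<ge> 3)" by blast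
  qed
  moreover have "p k = (\<Prod>a\<in>{1..card I}. config_factor A (Q a) (i a) (j a) (L a) k)" for k
  proof -
    have "(\<Prod>a\<in>{1..card I}. config_factor A (Q a) (i a) (j a) (L a) k) =
        (\<Prod>(O', l)\<in>I. config_factor A O' (i0 O') l (split_config mul (j0 O') l) k)"
      using prod.reindex_bij_betw[OF e, of "\<lambda>(O', l). config_factor A O' (i0 O') l (split_config mul (j0 O') l) k"]
      by (simp add: Q_def i_def j_def L_def case_prod_unfold)
    also have "\<dots> = (\<Prod>O'\<in>occurring_orbits. \<Prod>l\<in>J O'. config_factor A O' (i0 O') l (split_config mul (j0 O') l) k)"
      unfolding I_def using finite_occurring_orbits by (intro prod.Sigma[symmetric]) auto
    also have "\<dots> = (\<Prod>O'\<in>occurring_orbits. \<Prod>f\<in>{f \<in> edges A O' k. mul k f \<noteq> 0}. f ^ mul k f)"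
      using good_entriesD(1,2,4)[OF good] by (intro prod.cong refl prod_split_config)
    also have "\<dots> = p k" by (rule prod_occurring_orbits)
    finally show ?thesis ..
  qed
  ultimately show ?thesis by blast
qed

end

theorem mainTheorem1:
  fixes r :: "('m::finite \<Rightarrow>\<^sub>0 nat) rel"
    and A :: "'k::field_char_0 ^ 'n ^ 'm"
  assumes "CARD('n) \<ge> 2"
    and "monomial_order r"
  shows
    "(\<forall>p. (\<forall>k. monic r (p k)) \<and> consistent A p \<longrightarrow>
        (\<exists>d Q i j L. orbit_data r A d Q i j L \<and> orbits_distinct p d Q i j \<and>
           (\<forall>k. p k = (\<Prod>a\<in>{1..d}. config_factor A (Q a) (i a) (j a) (L a) k))))
   \<and> (\<forall>d Q i j L. orbit_data r A d Q i j L \<longrightarrow>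
        consistent A (\<lambda>k. \<Prod>a\<in>{1..d}. config_factor A (Q a) (i a) (j a) (L a) k))
   \<and> (\<forall>p. (\<forall>k. monic r (p k)) \<and> consistent A p \<longrightarrow>
        (\<forall>i j k. i \<noteq> j \<and> j \<noteq> k \<and> k \<noteq> i \<longrightarrow>
           (p k at_plus (- half_col A i - half_col A j)) * (p k at_plus (half_col A i + half_col A j)) =
           (p k at_plus (- half_col A i + half_col A j)) * (p k at_plus (half_col A i - half_col A j))))"
proof (intro conjI allI impI)
  fix p :: "'n \<Rightarrow> ('m, 'k) mpoly" assume p: "(\<forall>k. monic r (p k)) \<and> consistent A p"
  show "\<exists>d Q i j L. orbit_data r A d Q i j L \<and> orbits_distinct p d Q i j \<and>
      (\<forall>k. p k = (\<Prod>a\<in>{1..d}. config_factor A (Q a) (i a) (j a) (L a) k))"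
    by (rule orbit_decomposition[OF assms(2,1)]) (simp_all add: p)
next
  fix d Q i j L assume data: "orbit_data r A d Q i j L"
  show "consistent A (\<lambda>k. \<Prod>a\<in>{1..d}. config_factor A (Q a) (i a) (j a) (L a) k)"
  proof (rule consistent_prod)
    fix a assume "a \<in> {1..d}"
    then show "consistent A (config_factor A (Q a) (i a) (j a) (L a))"
      using data unfolding orbit_data_def by (intro consistent_config_factor[of "Q a" r]) simp_all
  qed
next
  fix p :: "'n \<Rightarrow> ('m, 'k) mpoly" and i j k :: 'n
  assume p: "(\<forall>k. monic r (p k)) \<and> consistent A p" and "i \<noteq> j \<and> j \<noteq> k \<and> k \<noteq> i"
  then show "(p k at_plus (- half_col A i - half_col A j)) * (p k at_plus (half_col A i + half_col A j)) =
      (p k at_plus (- half_col A i + half_col A j)) * (p k at_plus (half_col A i - half_col A j))"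
    by (intro second_difference_relation[OF assms(2)]) simp_all
qed

end
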